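(* Let $K:\mathbf{R}^d\times\mathbf{R}^d\to\mathbf{R}^d$ be continuous, with $K(z,z')+K(z',z)=0$ for all $z,z'$, and Lipschitz in each variable with constant $L$: $\sup_{z'}|K(z_1,z')-K(z_2,z')|\le L|z_1-z_2|$ and $\sup_{z}|K(z,z_1)-K(z,z_2)|\le L|z_1-z_2|$ for all $z_1,z_2\in\mathbf{R}^d$. For each $n\ge1$ let $T^n_t$ be the associated $n$-particle flow on $(\mathbf{R}^d)^n$. Let $M,N\ge1$, and let $P_M^{in}\in\mathcal{P}_1((\mathbf{R}^d)^M)$ and $Q_N^{in}\in\mathcal{P}_1((\mathbf{R}^d)^N)$ be symmetric. For each $t\in\mathbf{R}$, set $P_M(t):=T^M_t\#P_M^{in}$ and $Q_N(t):=T^N_t\#Q_N^{in}$. Then: (a) For each $t\in\mathbf{R}$, $$\operatorname{Dist}_{MK,1}(P_M(t),Q_N(t))\le e^{2L|t|}\operatorname{Dist}_{MK,1}(P_M^{in},Q_N^{in}).$$ (b) For each $t\in\mathbf{R}$, each integer $m\ge1$ such that $M,N\ge m$, and each bounded and Lipschitz continuous function $\phi_m$ on $(\mathbf{R}^d)^m$, $$|\langle P_{M:m}(t)-Q_{N:m}(t),\phi_m\rangle|\le m\left(e^{2L|t|}\operatorname{Lip}(\phi_m)\operatorname{Dist}_{MK,1}(P_M^{in},Q_N^{in})+(m-1)\|\phi_m\|_{L^\infty}\left(\frac1M+\frac1N\right)\right).$$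
   Context: $|\cdot|$ is the Euclidean norm; $(\mathbf{R}^d)^n$ is identified with $\mathbf{R}^{dn}$ with its Euclidean norm. $\mathcal{P}_1(\mathbf{R}^n)$ is the set of Borel probability measures $\mu$ on $\mathbf{R}^n$ with $\int|z|\,\mu(dz)<\infty$. The symbol $\#$ denotes push-forward of measures, $\langle\lambda,\phi\rangle=\int\phi\,d\lambda$, and $\operatorname{Lip}(\phi)=\sup_{x\ne y}|\phi(x)-\phi(y)|/|x-y|$. $n$-particle flow: $T^n_t(z_1^{in},\ldots,z_n^{in})=(z_1(t),\ldots,z_n(t))$, where $(z_1,\ldots,z_n)$ is the (global, unique) solution of $$\dot z_k(t)=\frac1n\sum_{l=1}^nK(z_k(t),z_l(t)),\qquad z_k(0)=z_k^{in},\qquad k=1,\ldots,n,\ t\in\mathbf{R}.$$ Empirical measure: for $Z_n=(z_1,\ldots,z_n)\in(\mathbf{R}^d)^n$, $\mu_{Z_n}=\frac1n\sum_{k=1}^n\delta_{z_k}$. Symmetry: a probability measure $P$ on $(\mathbf{R}^d)^n$ is symmetric if $S_\sigma\#P=P$ for every permutation $\sigma\in\mathfrak{S}_n$, where $S_\sigma(x_1,\ldots,x_n)=(x_{\sigma(1)},\ldots,x_{\sigma(n)})$. Marginals: $P_{M:m}(t)$ (resp. $Q_{N:m}(t)$) is the push-forward of $P_M(t)$ (resp. $Q_N(t)$) under the projection onto the first $m$ particles, $(z_1,\ldots,z_M)\mapsto(z_1,\ldots,z_m)$ (resp. $(z_1,\ldots,z_N)\mapsto(z_1,\ldots,z_m)$).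 Distances: for $\mu,\nu\in\mathcal{P}_1(\mathbf{R}^d)$, $\operatorname{dist}_{MK,1}(\mu,\nu)=\inf_{\pi\in\Pi(\mu,\nu)}\iint|x-y|\,\pi(dx\,dy)$. For symmetric $P\in\mathcal{P}_1((\mathbf{R}^d)^M)$ and $Q\in\mathcal{P}_1((\mathbf{R}^d)^N)$ (with $M$ and $N$ possibly different), $$\operatorname{Dist}_{MK,1}(P,Q)=\inf_{\rho\in\Pi(P,Q)}\iint_{(\mathbf{R}^d)^M\times(\mathbf{R}^d)^N}\operatorname{dist}_{MK,1}(\mu_{X_M},\mu_{Y_N})\,\rho(dX_M,dY_N).$$ In both cases $\Pi(\cdot,\cdot)$ denotes the set of Borel probability measures on the product space whose marginals are the two given measures. *)

theory Defs
  imports "HOL-Probability.Probability"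
begin

text \<open>
  Configurations of \<open>n\<close> particles in a Euclidean space \<open>'a\<close> are the functions on \<open>{..<n}\<close>
  (extended by \<^term>\<open>undefined\<close>), so particles are numbered from \<open>0\<close>.  As \<open>'a\<close> is second countable,
  the product \<open>\<sigma>\<close>-algebra on configurations is the Borel \<open>\<sigma>\<close>-algebra of \<open>'a\<^sup>n\<close>.  Only the
  space and the measurable sets of the following measure are ever used.
\<close>

abbreviation configs :: "nat \<Rightarrow> (nat \<Rightarrow> 'a::euclidean_space) measure" where
  "configs n \<equiv> PiM {..<n} (\<lambda>_. borel)"

definition config_dist ::
    "nat \<Rightarrow> (nat \<Rightarrow> 'a::euclidean_space) \<Rightarrow> (nat \<Rightarrow> 'a) \<Rightarrow> real" where
  "config_dist n x y = sqrt (\<Sum>i<n. (norm (x i - y i))\<^sup>2)"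

definition config_norm :: "nat \<Rightarrow> (nat \<Rightarrow> 'a::euclidean_space) \<Rightarrow> real" where
  "config_norm n x = sqrt (\<Sum>i<n. (norm (x i))\<^sup>2)"

definition P1_configs :: "nat \<Rightarrow> (nat \<Rightarrow> 'a::euclidean_space) measure set" where
  "P1_configs n = {P. prob_space P \<and> sets P = sets (configs n) \<and> integrable P (config_norm n)}"

definition permute_config ::
    "nat \<Rightarrow> (nat \<Rightarrow> nat) \<Rightarrow> (nat \<Rightarrow> 'a::euclidean_space) \<Rightarrow> nat \<Rightarrow> 'a" where
  "permute_config n \<sigma> x = (\<lambda>i\<in>{..<n}. x (\<sigma> i))"

definition symmetric_measure :: "nat \<Rightarrow> (nat \<Rightarrow> 'a::euclidean_space) measure \<Rightarrow> bool" where
  "symmetric_measure n P \<longleftrightarrow>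
     (\<forall>\<sigma>. \<sigma> permutes {..<n} \<longrightarrow> distr P (configs n) (permute_config n \<sigma>) = P)"

definition particle_solution ::
    "('a::euclidean_space \<Rightarrow> 'a \<Rightarrow> 'a) \<Rightarrow> nat \<Rightarrow> (nat \<Rightarrow> 'a) \<Rightarrow> (real \<Rightarrow> nat \<Rightarrow> 'a) \<Rightarrow> bool" where
  "particle_solution K n z0 z \<longleftrightarrow>
     z 0 = z0 \<and>
     (\<forall>t. z t \<in> space (configs n)) \<and>
     (\<forall>t. \<forall>k<n. ((\<lambda>s. z s k) has_vector_derivative
        (1 / real n) *\<^sub>R (\<Sum>l<n. K (z t k) (z t l))) (at t))"

text \<open>
  Meaningful when the system has exactly one global solution, as it does for Lipschitz \<open>K\<close> and
  \<open>z0\<close> in \<^term>\<open>space (configs n)\<close>.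
\<close>

definition particle_flow ::
    "('a::euclidean_space \<Rightarrow> 'a \<Rightarrow> 'a) \<Rightarrow> nat \<Rightarrow> real \<Rightarrow> (nat \<Rightarrow> 'a) \<Rightarrow> nat \<Rightarrow> 'a" where
  "particle_flow K n t z0 = (THE z. particle_solution K n z0 z) t"

definition evolve ::
    "('a::euclidean_space \<Rightarrow> 'a \<Rightarrow> 'a) \<Rightarrow> nat \<Rightarrow> real \<Rightarrow> (nat \<Rightarrow> 'a) measure \<Rightarrow> (nat \<Rightarrow> 'a) measure" where
  "evolve K n t P = distr P (configs n) (particle_flow K n t)"

definition marginal ::
    "nat \<Rightarrow> (nat \<Rightarrow> 'a::euclidean_space) measure \<Rightarrow> (nat \<Rightarrow> 'a) measure" where
  "marginal m P = distr P (configs m) (\<lambda>z. restrict z {..<m})"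

definition empirical_measure :: "nat \<Rightarrow> (nat \<Rightarrow> 'a::euclidean_space) \<Rightarrow> 'a measure" where
  "empirical_measure n z =
     measure_of UNIV (sets borel)
       (\<lambda>A. ennreal (1 / real n) * (\<Sum>k<n. emeasure (return borel (z k)) A))"

definition couplings :: "'b measure \<Rightarrow> 'c measure \<Rightarrow> ('b \<times> 'c) measure set" where
  "couplings \<mu> \<nu> =
     {\<pi>. prob_space \<pi> \<and> sets \<pi> = sets (\<mu> \<Otimes>\<^sub>M \<nu>) \<and> distr \<pi> \<mu> fst = \<mu> \<and> distr \<pi> \<nu> snd = \<nu>}"

text \<open>
  Both distances take values in \<^typ>\<open>ennreal\<close>, so that no convention for divergent integrals is
  involved.  They are finite on measures with finite first moment.
\<close>

definition dist_MK1 :: "'a::euclidean_space measure \<Rightarrow> 'a measure \<Rightarrow> ennreal" where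
  "dist_MK1 \<mu> \<nu> = (INF \<pi>\<in>couplings \<mu> \<nu>. \<integral>\<^sup>+ (x, y). ennreal (norm (x - y)) \<partial>\<pi>)"

definition Dist_MK1 ::
    "nat \<Rightarrow> nat \<Rightarrow> (nat \<Rightarrow> 'a::euclidean_space) measure \<Rightarrow> (nat \<Rightarrow> 'a) measure \<Rightarrow> ennreal" where
  "Dist_MK1 M N P Q =
     (INF \<rho>\<in>couplings P Q.
        \<integral>\<^sup>+ (X, Y). dist_MK1 (empirical_measure M X) (empirical_measure N Y) \<partial>\<rho>)"

definition bounded_config_fun :: "nat \<Rightarrow> ((nat \<Rightarrow> 'a::euclidean_space) \<Rightarrow> real) \<Rightarrow> bool" where
  "bounded_config_fun m \<phi> \<longleftrightarrow> (\<exists>B. \<forall>x\<in>space (configs m). \<bar>\<phi> x\<bar> \<le> B)"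

definition lipschitz_config_fun :: "nat \<Rightarrow> ((nat \<Rightarrow> 'a::euclidean_space) \<Rightarrow> real) \<Rightarrow> bool" where
  "lipschitz_config_fun m \<phi> \<longleftrightarrow>
     (\<exists>C. \<forall>x\<in>space (configs m). \<forall>y\<in>space (configs m). \<bar>\<phi> x - \<phi> y\<bar> \<le> C * config_dist m x y)"

definition Lip :: "nat \<Rightarrow> ((nat \<Rightarrow> 'a::euclidean_space) \<Rightarrow> real) \<Rightarrow> real" where
  "Lip m \<phi> =
     (SUP (x, y)\<in>{(x, y). x \<in> space (configs m) \<and> y \<in> space (configs m) \<and> x \<noteq> y}.
        \<bar>\<phi> x - \<phi> y\<bar> / config_dist m x y)"

text \<open>For continuous \<open>\<phi>\<close> the essential supremum is the supremum.\<close>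

definition Linf_norm :: "nat \<Rightarrow> ((nat \<Rightarrow> 'a::euclidean_space) \<Rightarrow> real) \<Rightarrow> real" where
  "Linf_norm m \<phi> = (SUP x\<in>space (configs m). \<bar>\<phi> x\<bar>)"

end

theory Submission
  imports Defs
begin

text \<open>
  A coupling of the empirical measures of \<open>X\<close> and \<open>Y\<close> lifts to a law \<open>p\<close> on index pairs with uniform
  marginals.  Indexed by such pairs, the flows from \<open>X\<close> and from \<open>Y\<close> become two solutions of one
  system whose particles carry the weights \<open>p\<close>, so Gronwall's inequality bounds the growth of the
  \<open>p\<close>-averaged distance by \<open>e\<^sup>2\<^sup>L\<^sup>|\<^sup>t\<^sup>|\<close>.  Taking infima over \<open>p\<close> and then over couplings
  of the initial laws gives (a).

  For (b), symmetry lets one replace \<open>\<phi>\<close> of the first \<open>m\<close> particles by its average over all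
  \<open>f : {0..<m} \<rightarrow> {0..<M}\<close> of the configurations \<open>X \<circ> f\<close>.  Only the non-injective \<open>f\<close>, a fraction of
  at most \<open>m (m - 1) / (2 M)\<close>, cause an error.  Coupling \<open>f\<close> and its analogue for \<open>N\<close> by \<open>m\<close>
  independent samples of \<open>p\<close>, the averages differ by at most \<open>m Lip(\<phi>)\<close> times the transport cost.
\<close>

section \<open>Global solutions of Lipschitz differential equations\<close>

text \<open>The two systems differ in size, so their trajectories cannot be paired one to one.
  Uniform marginals of \<open>p\<close> are exactly what makes each flow, read on index pairs,
  satisfy the \<open>p\<close>-weighted equation, and one and the same \<open>p\<close> then serves
  at time 0 and at time \<open>t\<close>. The rate is \<open>2 * L\<close> because the force on a
  particle changes with its own position and with those of the others, each at a cost of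
  \<open>L\<close>.

  A coupling of empirical measures sees points, not indices, and coinciding particles share one
  atom. Going from such a coupling to some \<open>p\<close> without raising the cost is the
  combinatorial core of (a).

  \<open>particle_flow\<close> is a definite description and \<open>distr\<close> is a push-forward
  only along measurable maps, so existence, uniqueness and measurability of the flow have to be
  established. The last two come from the same stability estimate, taken with the coupling that
  matches each particle with itself.

  In (b) a non-injective selection costs at most twice the bound of the test function. This 2
  cancels the 1/2 in the proportion of such selections and leaves
  \<open>m * (m - 1) / M\<close>.\<close>

lemma ex_antiderivative:
  fixes f :: "real \<Rightarrow> 'a::banach"
  assumes cont: "continuous_on UNIV f"
  shows "\<exists>g. g 0 = 0 \<and> (\<forall>t. (g has_vector_derivative f t) (at t))"
proof -
  \<comment> \<open>The oriented integral from 0 to \<open>t\<close>: over an empty interval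
    \<open>integral\<close> is 0, so at most one of the two terms is nonzero.\<close>
  define g where "g t = integral {0..t} f - integral {t..0} f" for t
  have int: "f integrable_on {a..b}" for a b
    by (rule integrable_continuous_interval) (rule continuous_on_subset[OF cont], simp)
  have "(g has_vector_derivative f t) (at t)" for t
  proof -
    \<comment> \<open>Near \<open>t\<close> the function \<open>g\<close> differs by a constant from
      the integral with fixed lower limit \<open>-T\<close>. Both 0 and \<open>t\<close> are
      interior to \<open>{-T..T}\<close>.\<close>
    define T where "T = \<bar>t\<bar> + 1"
    have eq: "g s = integral {-T..s} f - integral {-T..0} f" if "s \<in> {-T<..<T}" for s
    proof (cases "s \<ge> 0")
      case True
      have "integral {-T..0} f + integral {0..s} f = integral {-T..s} f"
        using True that by (intro Henstock_Kurzweil_Integration.integral_combine int) (auto simp: T_def)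
      moreover have "integral {s..0} f = 0"
        using True by (cases "s = 0") auto
      ultimately show ?thesis by (simp add: g_def algebra_simps)
    next
      case False
      have "integral {-T..s} f + integral {s..0} f = integral {-T..0} f"
        using False that by (intro Henstock_Kurzweil_Integration.integral_combine int) auto
      moreover have "integral {0..s} f = 0"
        using False by auto
      ultimately show ?thesis by (simp add: g_def algebra_simps)
    qed
    have "((\<lambda>s. integral {-T..s} f) has_vector_derivative f t) (at t within {-T..T})"
      by (rule integral_has_vector_derivative)
        (auto simp: T_def intro: continuous_on_subset[OF cont])
    hence "((\<lambda>s. integral {-T..s} f) has_vector_derivative f t) (at t)"
      by (subst (asm) at_within_interior) (auto simp: T_def)
    hence "((\<lambda>s. integral {-T..s} f - integral {-T..0} f) has_vector_derivative f t - 0) (at t)"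
      by (intro derivative_intros)
    thus ?thesis
      using eq
      by (intro has_vector_derivative_transform_within_open
          [of "\<lambda>s. integral {-T..s} f - integral {-T..0} f" _ t "{-T<..<T}" g])
         (auto simp: T_def)
  qed
  moreover have "g 0 = 0" by (simp add: g_def)
  ultimately show ?thesis by blast
qed

lemma has_vector_derivative_reverse:
  fixes g :: "real \<Rightarrow> 'a::real_normed_vector"
  assumes "\<And>t. (g has_vector_derivative f t) (at t)"
  shows "((\<lambda>t. g (- t)) has_vector_derivative - f (- t)) (at t)"
proof -
  have "((g \<circ> uminus) has_vector_derivative (-1) *\<^sub>R f (- t)) (at t)"
    by (rule vector_diff_chain_at) (auto intro!: derivative_eq_intros assms)
  thus ?thesis by (simp add: o_def)
qed

text \<open>The antiderivative of the majorant \<open>C * exp (l * s)\<close> is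
  \<open>C / l * exp (l * s)\<close>, and negative times are reflected. The gain of
  \<open>1 / l\<close> is what later makes the fixed point map a contraction.\<close>

lemma norm_antiderivative_le_exp:
  fixes g :: "real \<Rightarrow> 'a::real_normed_vector"
  assumes "g 0 = 0" and "\<And>t. (g has_vector_derivative f t) (at t)"
    and "\<And>t. norm (f t) \<le> C * exp (l * \<bar>t\<bar>)" and l: "l > 0"
  shows "norm (g t) \<le> C / l * exp (l * \<bar>t\<bar>)"
proof -
  have "norm (f 0) \<le> C" using assms(3)[of 0] by simp
  hence C: "0 \<le> C" using norm_ge_zero order_trans by blast
  have pos: "norm (g t) \<le> C / l * exp (l * t)"
    if "g 0 = 0" and g: "\<And>t. (g has_vector_derivative f t) (at t)"
      and f: "\<And>t. norm (f t) \<le> C * exp (l * \<bar>t\<bar>)" and "t \<ge> 0" for g f :: "real \<Rightarrow> 'a" and t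
  proof (cases "t = 0")
    case False
    have "norm (g t - g 0) \<le> C / l * exp (l * t) - C / l * exp (l * 0)"
    proof (rule differentiable_bound_general[where f = g and \<phi> = "\<lambda>s. C / l * exp (l * s)"])
      show "0 < t" using False that by simp
      show "continuous_on {0..t} g"
        by (meson continuous_at_imp_continuous_on has_vector_derivative_continuous g)
      show "(g has_vector_derivative f x) (at x)" for x by (rule g)
      show "((\<lambda>s. C / l * exp (l * s)) has_vector_derivative C * exp (l * x)) (at x)" for x
        unfolding has_real_derivative_iff_has_vector_derivative[symmetric]
        using l by (auto intro!: derivative_eq_intros)
      show "norm (f x) \<le> C * exp (l * x)" if "0 < x" for x using f[of x] that by simp
    qed (use l in \<open>auto intro!: continuous_intros\<close>)
    moreover have "0 \<le> C / l" using C l by simp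
    ultimately show ?thesis using that by simp
  qed (use that C l in auto)
  show ?thesis
  proof (cases "t \<ge> 0")
    case True
    thus ?thesis using pos[OF assms(1-3)] by simp
  next
    case False
    have "norm ((\<lambda>t. g (- t)) (- t)) \<le> C / l * exp (l * (- t))"
      using False assms
      by (intro pos[OF _ has_vector_derivative_reverse[of g f]])
        (auto intro: order_trans[OF assms(3)])
    thus ?thesis using False by simp
  qed
qed

text \<open>Banach's fixed point theorem for the integral equation satisfied by
  \<open>u(t) = e\<^sup>-\<^sup>l\<^sup>|\<^sup>t\<^sup>| (z(t) - x\<^sub>0)\<close>; for \<open>l\<close> larger than the Lipschitz constant the exponential
  weight makes it a contraction on all of \<open>\<real>\<close> at once.\<close>

theorem ex_global_solution:
  fixes F :: "'a::banach \<Rightarrow> 'a"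
  assumes lip: "\<And>x y. norm (F x - F y) \<le> \<Lambda> * norm (x - y)" and \<Lambda>: "0 \<le> \<Lambda>"
  shows "\<exists>z. z 0 = x0 \<and> (\<forall>t. (z has_vector_derivative F (z t)) (at t))"
proof -
  \<comment> \<open>Makes \<open>\<Lambda> / l\<close> less than 1, and keeps \<open>l\<close>
    positive even when \<open>\<Lambda> = 0\<close>.\<close>
  define l where "l = 2 * \<Lambda> + 1"
  have l: "l > 0" using \<Lambda> by (simp add: l_def)
  have "\<Lambda>-lipschitz_on UNIV F"
    using lip \<Lambda> by (auto intro!: lipschitz_onI simp: dist_norm)
  hence contF: "continuous_on A F" for A
    by (meson continuous_on_subset lipschitz_on_continuous_on subset_UNIV)
  \<comment> \<open>Undoing the exponential weight turns \<open>u\<close> into a candidate solution;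
    \<open>h u\<close> is the vector field along it.\<close>
  define h where "h u t = F (x0 + exp (l * \<bar>t\<bar>) *\<^sub>R apply_bcontfun u t)"
    for u :: "real \<Rightarrow>\<^sub>C 'a" and t
  have conth: "continuous_on UNIV (h u)" for u
    unfolding h_def
    by (rule continuous_on_compose2[OF contF[of UNIV]]) (auto intro!: continuous_intros)
  have "\<forall>u. \<exists>g. g 0 = 0 \<and> (\<forall>t. (g has_vector_derivative h u t) (at t))"
    using ex_antiderivative[OF conth] by blast
  then obtain G where G0: "\<And>u. G u 0 = 0"
    and G: "\<And>u t. (G u has_vector_derivative h u t) (at t)"
    by metis
  define \<Phi> where "\<Phi> u = Bcontfun (\<lambda>t. exp (- l * \<bar>t\<bar>) *\<^sub>R G u t)" for u
  \<comment> \<open>Guarantees that the weighted antiderivative is bounded, so that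
    \<open>Bcontfun\<close> in \<open>\<Phi>\<close> represents it faithfully.\<close>
  have Gbound: "norm (G u t) \<le> (norm (F x0) + \<Lambda> * norm u) / l * exp (l * \<bar>t\<bar>)" for u t
  proof (rule norm_antiderivative_le_exp[OF G0 G _ l])
    fix t
    have "norm (h u t) \<le> norm (F x0) + norm (h u t - F x0)"
      using norm_triangle_sub by blast
    also have "norm (h u t - F x0) \<le> \<Lambda> * (exp (l * \<bar>t\<bar>) * norm (apply_bcontfun u t))"
      unfolding h_def by (rule order_trans[OF lip]) simp
    also have "\<dots> \<le> \<Lambda> * (exp (l * \<bar>t\<bar>) * norm u)"
      using \<Lambda> by (intro mult_left_mono norm_bounded) auto
    also have "norm (F x0) \<le> norm (F x0) * exp (l * \<bar>t\<bar>)"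
      using l by (simp add: mult_le_cancel_left1)
    finally show "norm (h u t) \<le> (norm (F x0) + \<Lambda> * norm u) * exp (l * \<bar>t\<bar>)"
      by (simp add: algebra_simps)
  qed
  have \<Phi>: "apply_bcontfun (\<Phi> u) t = exp (- l * \<bar>t\<bar>) *\<^sub>R G u t" for u t
    unfolding \<Phi>_def
  proof (subst Bcontfun_inverse[OF bcontfun_normI])
    have "continuous_on UNIV (G u)"
      by (meson continuous_at_imp_continuous_on has_vector_derivative_continuous G)
    thus "continuous_on UNIV (\<lambda>t. exp (- l * \<bar>t\<bar>) *\<^sub>R G u t)"
      by (intro continuous_intros)
    show "norm (exp (- l * \<bar>t\<bar>) *\<^sub>R G u t) \<le> (norm (F x0) + \<Lambda> * norm u) / l" for t
      using Gbound[of u t] by (simp add: exp_minus field_simps)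
  qed simp
  have contraction: "dist (\<Phi> u) (\<Phi> v) \<le> \<Lambda> / l * dist u v" for u v
  proof (rule dist_bound)
    fix t
    have "norm ((\<lambda>t. G u t - G v t) t) \<le> (\<Lambda> * dist u v) / l * exp (l * \<bar>t\<bar>)"
    proof (rule norm_antiderivative_le_exp[OF _ _ _ l])
      show "((\<lambda>t. G u t - G v t) has_vector_derivative h u t - h v t) (at t)" for t
        by (intro derivative_intros G)
      fix t
      have "norm (h u t - h v t)
          \<le> \<Lambda> * norm (exp (l * \<bar>t\<bar>) *\<^sub>R (apply_bcontfun u t - apply_bcontfun v t))"
        unfolding h_def by (rule order_trans[OF lip]) (simp add: algebra_simps)
      also have "\<dots> \<le> \<Lambda> * (exp (l * \<bar>t\<bar>) * dist u v)"
        using \<Lambda> dist_bounded[of u t v] by (auto intro!: mult_left_mono simp: dist_norm)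
      finally show "norm (h u t - h v t) \<le> \<Lambda> * dist u v * exp (l * \<bar>t\<bar>)"
        by (simp add: algebra_simps)
    qed (simp add: G0)
    hence "exp (- l * \<bar>t\<bar>) * norm (G u t - G v t) \<le> \<Lambda> / l * dist u v"
      by (simp add: exp_minus field_simps)
    thus "dist (apply_bcontfun (\<Phi> u) t) (apply_bcontfun (\<Phi> v) t) \<le> \<Lambda> / l * dist u v"
      by (simp add: \<Phi> dist_norm flip: scaleR_diff_right)
  qed
  have "\<exists>!u. \<Phi> u = u"
    using \<Lambda> l contraction by (intro banach_fix_type[of "\<Lambda> / l"]) (auto simp: l_def)
  then obtain u where u: "\<Phi> u = u" by blast
  \<comment> \<open>Multiplying the fixed point equation by the inverse weight gives back the
    integral equation.\<close>
  have "x0 + exp (l * \<bar>t\<bar>) *\<^sub>R apply_bcontfun u t = x0 + G u t" for t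
    using \<Phi>[of u t] by (simp add: u exp_minus)
  hence "h u = (\<lambda>t. F (x0 + G u t))" by (simp add: h_def fun_eq_iff)
  hence "((\<lambda>t. x0 + G u t) has_vector_derivative F (x0 + G u t)) (at t)" for t
    using has_vector_derivative_add[OF has_vector_derivative_const G[of u t], of x0] by simp
  thus ?thesis using G0 by (intro exI[of _ "\<lambda>t. x0 + G u t"]) simp
qed

section \<open>Stability of weighted particle systems\<close>

text \<open>The distance \<open>\<delta> s\<close> need not be differentiable where it vanishes, so
  Gronwall's argument runs on the antiderivatives \<open>G s\<close> of \<open>\<delta> s\<close>
  and \<open>A\<close> of the average \<open>D\<close>. The velocities of a pair differ by at most
  \<open>L * \<delta> s + L * D\<close>; integrating and averaging with \<open>w\<close> gives
  \<open>D t \<le> D 0 + 2 * L * A t\<close>.\<close>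

lemma weighted_stability_forward:
  fixes u v :: "'s \<Rightarrow> real \<Rightarrow> 'a::real_normed_vector" and K :: "'a \<Rightarrow> 'a \<Rightarrow> 'a"
  assumes S: "finite S" and w: "\<And>s. s \<in> S \<Longrightarrow> 0 \<le> w s" "(\<Sum>s\<in>S. w s) = 1"
    and K1: "\<And>x y z. norm (K x z - K y z) \<le> L * norm (x - y)"
    and K2: "\<And>x y z. norm (K z x - K z y) \<le> L * norm (x - y)"
    and u: "\<And>s t. s \<in> S \<Longrightarrow> (u s has_vector_derivative (\<Sum>r\<in>S. w r *\<^sub>R K (u s t) (u r t))) (at t)"
    and v: "\<And>s t. s \<in> S \<Longrightarrow> (v s has_vector_derivative (\<Sum>r\<in>S. w r *\<^sub>R K (v s t) (v r t))) (at t)"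
    and L: "0 \<le> L" and t: "0 \<le> t"
  shows "(\<Sum>s\<in>S. w s * norm (u s t - v s t)) \<le> exp (2 * L * t) * (\<Sum>s\<in>S. w s * norm (u s 0 - v s 0))"
proof -
  define \<delta> where "\<delta> s t = norm (u s t - v s t)" for s t
  define D where "D t = (\<Sum>s\<in>S. w s * \<delta> s t)" for t
  have cont: "continuous_on A (u s)" "continuous_on A (v s)" if "s \<in> S" for s A
    using that
    by (meson continuous_at_imp_continuous_on has_vector_derivative_continuous u v)+
  have cont\<delta>: "continuous_on A (\<delta> s)" if "s \<in> S" for s A
    using that unfolding \<delta>_def by (intro continuous_intros cont)
  have contD: "continuous_on A D" for A
    unfolding D_def by (intro continuous_intros cont\<delta>)
  have "\<forall>s\<in>S. \<exists>g. g 0 = 0 \<and> (\<forall>t. (g has_vector_derivative \<delta> s t) (at t))"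
    using ex_antiderivative cont\<delta> by blast
  then obtain G where G0: "\<And>s. s \<in> S \<Longrightarrow> G s 0 = 0"
    and G: "\<And>s t. s \<in> S \<Longrightarrow> (G s has_vector_derivative \<delta> s t) (at t)"
    by metis
  obtain A where A0: "A 0 = 0" and A: "\<And>t. (A has_vector_derivative D t) (at t)"
    using ex_antiderivative[OF contD[of UNIV]] by blast
  \<comment> \<open>Integration in time commutes with the weighted sum: both sides vanish at 0 and
    have the same derivative.\<close>
  have A_eq: "A t = (\<Sum>s\<in>S. w s * G s t)" for t
  proof -
    have "((\<lambda>t. A t - (\<Sum>s\<in>S. w s * G s t)) has_vector_derivative
             D t - (\<Sum>s\<in>S. w s * \<delta> s t)) (at t within UNIV)" for t
      by (intro has_vector_derivative_diff A has_vector_derivative_sum has_vector_derivative_mult_right)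
        (simp add: G)
    hence "((\<lambda>t. A t - (\<Sum>s\<in>S. w s * G s t)) has_vector_derivative 0) (at t within UNIV)" for t
      by (simp add: D_def)
    hence "\<exists>c. \<forall>t. A t - (\<Sum>s\<in>S. w s * G s t) = c"
      by (rule has_vector_derivative_zero_constant[OF convex_UNIV]) auto
    then obtain c where c: "\<And>t. A t - (\<Sum>s\<in>S. w s * G s t) = c" by auto
    from c[of 0] have "c = 0" by (simp add: A0 G0)
    with c[of t] show ?thesis by simp
  qed
  have diff_le: "norm ((\<Sum>r\<in>S. w r *\<^sub>R K (u s t) (u r t)) - (\<Sum>r\<in>S. w r *\<^sub>R K (v s t) (v r t)))
      \<le> L * \<delta> s t + L * D t" if "s \<in> S" for s t
  proof -
    have "norm (\<Sum>r\<in>S. w r *\<^sub>R (K (u s t) (u r t) - K (v s t) (v r t)))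
        \<le> (\<Sum>r\<in>S. w r * (L * \<delta> s t + L * \<delta> r t))"
    proof (rule sum_norm_le)
      fix r assume r: "r \<in> S"
      have "norm (K (u s t) (u r t) - K (v s t) (v r t))
          \<le> norm (K (u s t) (u r t) - K (v s t) (u r t)) + norm (K (v s t) (u r t) - K (v s t) (v r t))"
        by (rule norm_diff_triangle_le[OF order_refl order_refl])
      also have "\<dots> \<le> L * \<delta> s t + L * \<delta> r t"
        unfolding \<delta>_def by (intro add_mono K1 K2)
      finally show "norm (w r *\<^sub>R (K (u s t) (u r t) - K (v s t) (v r t))) \<le> w r * (L * \<delta> s t + L * \<delta> r t)"
        using w(1)[OF r] by (simp add: mult_left_mono)
    qed
    also have "\<dots> = (\<Sum>r\<in>S. w r) * (L * \<delta> s t) + L * D t"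
      by (simp add: D_def ring_distribs sum.distrib sum_distrib_left sum_distrib_right mult_ac)
    finally show ?thesis using w(2) by (simp add: sum_subtractf scaleR_diff_right)
  qed
  have \<delta>_le: "\<delta> s t \<le> \<delta> s 0 + L * G s t + L * A t" if s: "s \<in> S" and t: "0 \<le> t" for s t
  proof (cases "t = 0")
    case False
    have "norm ((u s t - v s t) - (u s 0 - v s 0)) \<le> (L * G s t + L * A t) - (L * G s 0 + L * A 0)"
    proof (rule differentiable_bound_general
        [where f = "\<lambda>t. u s t - v s t" and \<phi> = "\<lambda>t. L * G s t + L * A t"])
      show "0 < t" using t False by simp
      show "continuous_on {0..t} (\<lambda>t. u s t - v s t)"
        using cont s by (intro continuous_intros)
      show "((\<lambda>t. u s t - v s t) has_vector_derivative
          (\<Sum>r\<in>S. w r *\<^sub>R K (u s x) (u r x)) - (\<Sum>r\<in>S. w r *\<^sub>R K (v s x) (v r x))) (at x)" for x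
        by (intro has_vector_derivative_diff u v s)
      show deriv: "((\<lambda>t. L * G s t + L * A t) has_vector_derivative L * \<delta> s x + L * D x) (at x)" for x
        by (intro has_vector_derivative_add has_vector_derivative_mult_right G[OF s] A)
      show "continuous_on {0..t} (\<lambda>t. L * G s t + L * A t)"
        by (intro continuous_at_imp_continuous_on ballI has_vector_derivative_continuous[OF deriv])
    qed (use diff_le s in auto)
    moreover have "\<delta> s t \<le> \<delta> s 0 + norm ((u s t - v s t) - (u s 0 - v s 0))"
      unfolding \<delta>_def by (rule norm_triangle_sub)
    ultimately show ?thesis by (simp add: G0[OF s] A0)
  qed (simp add: G0 s A0)
  have D_le: "D t \<le> D 0 + 2 * L * A t" if "0 \<le> t" for t
  proof -
    have "D t \<le> (\<Sum>s\<in>S. w s * (\<delta> s 0 + L * G s t + L * A t))"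
      unfolding D_def using \<delta>_le that w by (intro sum_mono mult_left_mono) auto
    also have "\<dots> = D 0 + L * (\<Sum>s\<in>S. w s * G s t) + (\<Sum>s\<in>S. w s) * (L * A t)"
      by (simp add: D_def ring_distribs sum.distrib sum_distrib_left sum_distrib_right mult_ac)
    finally show ?thesis by (simp add: w(2) flip: A_eq)
  qed
  \<comment> \<open>Integrating factor: the derivative of this product has the sign of
    \<open>D x - (D 0 + 2 * L * A x)\<close>, which is nonpositive by \<open>D_le\<close>.\<close>
  have "exp (- (2 * L * t)) * (D 0 + 2 * L * A t) \<le> exp (- (2 * L * 0)) * (D 0 + 2 * L * A 0)"
  proof (rule DERIV_nonpos_imp_nonincreasing[OF t])
    fix x :: real assume x: "0 \<le> x" "x \<le> t"
    have "((\<lambda>x. exp (- (2 * L * x)) * (D 0 + 2 * L * A x)) has_real_derivative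
        exp (- (2 * L * x)) * (2 * L * (D x - (D 0 + 2 * L * A x)))) (at x)"
      using A[of x, unfolded has_real_derivative_iff_has_vector_derivative[symmetric]]
      by (auto intro!: derivative_eq_intros simp: algebra_simps)
    thus "\<exists>y. ((\<lambda>x. exp (- (2 * L * x)) * (D 0 + 2 * L * A x)) has_real_derivative y) (at x) \<and> y \<le> 0"
      using D_le[OF x(1)] L by (intro exI conjI) (auto simp: mult_nonneg_nonpos)
  qed
  hence "D 0 + 2 * L * A t \<le> exp (2 * L * t) * D 0"
    by (simp add: A0 exp_minus field_simps)
  with D_le[OF t] show ?thesis by (simp add: D_def \<delta>_def)
qed

text \<open>Negative times reduce to positive ones by reversing time, which replaces \<open>K\<close> by \<open>- K\<close>.\<close>

lemma weighted_stability:
  fixes u v :: "'s \<Rightarrow> real \<Rightarrow> 'a::real_normed_vector" and K :: "'a \<Rightarrow> 'a \<Rightarrow> 'a"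
  assumes S: "finite S" and w: "\<And>s. s \<in> S \<Longrightarrow> 0 \<le> w s" "(\<Sum>s\<in>S. w s) = 1"
    and K1: "\<And>x y z. norm (K x z - K y z) \<le> L * norm (x - y)"
    and K2: "\<And>x y z. norm (K z x - K z y) \<le> L * norm (x - y)"
    and u: "\<And>s t. s \<in> S \<Longrightarrow> (u s has_vector_derivative (\<Sum>r\<in>S. w r *\<^sub>R K (u s t) (u r t))) (at t)"
    and v: "\<And>s t. s \<in> S \<Longrightarrow> (v s has_vector_derivative (\<Sum>r\<in>S. w r *\<^sub>R K (v s t) (v r t))) (at t)"
    and L: "0 \<le> L"
  shows "(\<Sum>s\<in>S. w s * norm (u s t - v s t))
      \<le> exp (2 * L * \<bar>t\<bar>) * (\<Sum>s\<in>S. w s * norm (u s 0 - v s 0))"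
proof (cases "0 \<le> t")
  case True
  thus ?thesis using weighted_stability_forward[OF S w K1 K2 u v L True] by simp
next
  case False
  have reverse: "((\<lambda>t. y s (- t)) has_vector_derivative
      (\<Sum>r\<in>S. w r *\<^sub>R - K (y s (- t)) (y r (- t)))) (at t)"
    if "s \<in> S" and "\<And>s t. s \<in> S \<Longrightarrow>
      (y s has_vector_derivative (\<Sum>r\<in>S. w r *\<^sub>R K (y s t) (y r t))) (at t)"
    for y :: "'s \<Rightarrow> real \<Rightarrow> 'a" and s t
    using has_vector_derivative_reverse[OF that(2)[OF that(1)], of t] by (simp add: sum_negf)
  have "(\<Sum>s\<in>S. w s * norm (u s (- (- t)) - v s (- (- t))))
      \<le> exp (2 * L * (- t)) * (\<Sum>s\<in>S. w s * norm (u s (- 0) - v s (- 0)))"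
    using K1 K2 L False
    by (intro weighted_stability_forward[where K = "\<lambda>x y. - K x y"] S w reverse u v)
      (auto simp: norm_minus_commute)
  thus ?thesis using False by simp
qed

section \<open>The particle flow\<close>

lemma space_configs: "space (configs n) = {..<n} \<rightarrow>\<^sub>E UNIV"
  by (simp add: space_PiM)

text \<open>Extends \<open>G\<close> by restriction to all of \<open>nat \<Rightarrow> 'a\<close>.
  There the product sigma-algebra is the Borel one of the product topology, and the estimate,
  involving finitely many coordinates, gives continuity.\<close>

lemma borel_measurable_configsI:
  fixes G :: "(nat \<Rightarrow> 'a::euclidean_space) \<Rightarrow> 'b::metric_space"
  assumes G: "\<And>x y. x \<in> space (configs n) \<Longrightarrow> y \<in> space (configs n) \<Longrightarrow>
    dist (G x) (G y) \<le> C * (\<Sum>i<n. norm (x i - y i))"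
  shows "G \<in> borel_measurable (configs n)"
proof -
  define H where "H x = G (restrict x {..<n})" for x
  have "continuous_on UNIV H"
    unfolding continuous_on_def
  proof safe
    fix y :: "nat \<Rightarrow> 'a"
    define b where "b x = C * (\<Sum>i<n. norm (x i - y i))" for x
    have "continuous_on UNIV b"
      unfolding b_def by (intro continuous_intros continuous_on_product_coordinates)
    hence "(b \<longlongrightarrow> b y) (at y)" by (simp add: continuous_on_def)
    hence b: "(b \<longlongrightarrow> 0) (at y)" by (simp add: b_def)
    have "dist (H x) (H y) \<le> b x" for x
      unfolding H_def b_def by (rule order_trans[OF G]) (auto simp: space_configs)
    hence "((\<lambda>x. dist (H x) (H y)) \<longlongrightarrow> 0) (at y)"
      by (intro tendsto_sandwich[OF _ _ tendsto_const b]) auto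
    thus "(H \<longlongrightarrow> H y) (at y)"
      using tendsto_dist_iff by blast
  qed
  hence "H \<in> borel_measurable borel"
    by (rule borel_measurable_continuous_onI)
  hence H: "H \<in> borel_measurable (PiM UNIV (\<lambda>_. borel))"
    by (simp cong: measurable_cong_sets add: sets_PiM_equal_borel)
  \<comment> \<open>Padding with 0 embeds configurations measurably into full sequences; the
    restriction inside \<open>H\<close> undoes it.\<close>
  have "(\<lambda>x i. if i < n then x i else 0) \<in> measurable (configs n) (PiM UNIV (\<lambda>_. borel :: 'a measure))"
  proof (rule measurable_PiM_single')
    show "(\<lambda>x. if i < n then x i else 0) \<in> borel_measurable (configs n)" for i
      by (cases "i < n") (auto intro: measurable_component_singleton)
  qed (auto simp: space_PiM)
  from measurable_compose[OF this H]
  have "(\<lambda>x. H (\<lambda>i. if i < n then x i else 0)) \<in> borel_measurable (configs n)" .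
  also have "?this \<longleftrightarrow> ?thesis"
  proof (rule measurable_cong)
    fix x :: "nat \<Rightarrow> 'a" assume "x \<in> space (configs n)"
    hence "restrict (\<lambda>i. if i < n then x i else 0) {..<n} = x"
      by (auto simp: space_configs PiE_def extensional_def restrict_def fun_eq_iff)
    thus "H (\<lambda>i. if i < n then x i else 0) = G x" by (simp add: H_def)
  qed
  finally show ?thesis .
qed

section \<open>Couplings of uniform index distributions\<close>

definition index_couplings :: "nat \<Rightarrow> nat \<Rightarrow> (nat \<times> nat) pmf set" where
  "index_couplings M N =
     {p. map_pmf fst p = pmf_of_set {..<M} \<and> map_pmf snd p = pmf_of_set {..<N}}"

lemma set_pmf_index_coupling:
  assumes "p \<in> index_couplings M N" "0 < M" "0 < N"
  shows "set_pmf p \<subseteq> {..<M} \<times> {..<N}"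
proof -
  have "fst ` set_pmf p = set_pmf (pmf_of_set {..<M})" "snd ` set_pmf p = set_pmf (pmf_of_set {..<N})"
    using assms by (auto simp: index_couplings_def simp flip: set_map_pmf)
  hence "fst ` set_pmf p = {..<M}" "snd ` set_pmf p = {..<N}"
    using assms by (auto simp: set_pmf_of_set lessThan_empty_iff)
  thus ?thesis using subset_fst_snd[of "set_pmf p"] by simp
qed

lemma integral_index_coupling:
  fixes f :: "nat \<times> nat \<Rightarrow> 'b::euclidean_space"
  assumes "p \<in> index_couplings M N" "0 < M" "0 < N"
  shows "measure_pmf.expectation p f = (\<Sum>s\<in>{..<M}\<times>{..<N}. pmf p s *\<^sub>R f s)"
  using set_pmf_index_coupling[OF assms] by (intro integral_measure_pmf) auto

lemma integral_pmf_of_set_lessThan: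
  fixes f :: "nat \<Rightarrow> 'b::euclidean_space"
  assumes "0 < n"
  shows "measure_pmf.expectation (pmf_of_set {..<n}) f = (1 / real n) *\<^sub>R (\<Sum>i<n. f i)"
  using assms
  by (subst integral_measure_pmf[of "{..<n}"])
    (auto simp: set_pmf_of_set lessThan_empty_iff scaleR_sum_right)

text \<open>Here the uniform marginals enter: a mean-field force averaged over index pairs with
  weights \<open>p\<close> is the original force, whatever the coupling \<open>p\<close>.\<close>

lemma
  fixes f :: "nat \<Rightarrow> 'b::euclidean_space"
  assumes p: "p \<in> index_couplings M N" and "0 < M" "0 < N"
  shows sum_index_coupling_fst:
      "(\<Sum>s\<in>{..<M}\<times>{..<N}. pmf p s *\<^sub>R f (fst s)) = (1 / real M) *\<^sub>R (\<Sum>i<M. f i)"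
    and sum_index_coupling_snd:
      "(\<Sum>s\<in>{..<M}\<times>{..<N}. pmf p s *\<^sub>R f (snd s)) = (1 / real N) *\<^sub>R (\<Sum>i<N. f i)"
proof -
  have "measure_pmf.expectation p (\<lambda>s. f (fst s)) = measure_pmf.expectation (pmf_of_set {..<M}) f"
    "measure_pmf.expectation p (\<lambda>s. f (snd s)) = measure_pmf.expectation (pmf_of_set {..<N}) f"
    using p by (auto simp: index_couplings_def simp flip: integral_map_pmf)
  thus "(\<Sum>s\<in>{..<M}\<times>{..<N}. pmf p s *\<^sub>R f (fst s)) = (1 / real M) *\<^sub>R (\<Sum>i<M. f i)"
    "(\<Sum>s\<in>{..<M}\<times>{..<N}. pmf p s *\<^sub>R f (snd s)) = (1 / real N) *\<^sub>R (\<Sum>i<N. f i)"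
    using assms by (auto simp: integral_index_coupling integral_pmf_of_set_lessThan)
qed

text \<open>Matches each particle with itself, which specialises the comparison of two systems to
  uniqueness and to Lipschitz dependence on the initial configuration of a single one.\<close>

definition diagonal_coupling :: "nat \<Rightarrow> (nat \<times> nat) pmf" where
  "diagonal_coupling n = map_pmf (\<lambda>i. (i, i)) (pmf_of_set {..<n})"

lemma diagonal_coupling: "diagonal_coupling n \<in> index_couplings n n"
  by (simp add: diagonal_coupling_def index_couplings_def map_pmf_comp)

lemma integral_diagonal_coupling:
  fixes f :: "nat \<Rightarrow> nat \<Rightarrow> 'b::euclidean_space"
  assumes "0 < n"
  shows "measure_pmf.expectation (diagonal_coupling n) (\<lambda>(i, j). f i j) = (1 / real n) *\<^sub>R (\<Sum>i<n. f i i)"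
  using assms by (simp add: diagonal_coupling_def integral_pmf_of_set_lessThan)

text \<open>Makes \<open>ex_global_solution\<close> applicable in a space of bounded continuous
  functions, where configurations are embedded below.\<close>

instance bcontfun :: (metric_space, banach) banach ..

locale lipschitz_interaction =
  fixes K :: "'a::euclidean_space \<Rightarrow> 'a \<Rightarrow> 'a" and L :: real
  assumes K1: "norm (K x z - K y z) \<le> L * norm (x - y)"
    and K2: "norm (K z x - K z y) \<le> L * norm (x - y)"
    and L: "0 \<le> L"
begin

lemma particle_solution_stability:
  assumes z: "particle_solution K M x z" and w: "particle_solution K N y w"
    and p: "p \<in> index_couplings M N" and MN: "0 < M" "0 < N"
  shows "measure_pmf.expectation p (\<lambda>(i, j). norm (z t i - w t j))
    \<le> exp (2 * L * \<bar>t\<bar>) * measure_pmf.expectation p (\<lambda>(i, j). norm (x i - y j))"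
proof -
  let ?S = "{..<M} \<times> {..<N}"
  have "(\<Sum>s\<in>?S. pmf p s * norm (z t (fst s) - w t (snd s)))
      \<le> exp (2 * L * \<bar>t\<bar>) * (\<Sum>s\<in>?S. pmf p s * norm (z 0 (fst s) - w 0 (snd s)))"
  proof (rule weighted_stability[where K = K and u = "\<lambda>s t. z t (fst s)" and v = "\<lambda>s t. w t (snd s)"])
    show "(\<Sum>s\<in>?S. pmf p s) = 1"
      using set_pmf_index_coupling[OF p MN] by (intro sum_pmf_eq_1) auto
    show "((\<lambda>t. z t (fst s)) has_vector_derivative
        (\<Sum>r\<in>?S. pmf p r *\<^sub>R K (z t (fst s)) (z t (fst r)))) (at t)" if "s \<in> ?S" for s t
      unfolding sum_index_coupling_fst[OF p MN, of "\<lambda>k. K (z t (fst s)) (z t k)"]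
      using z that by (auto simp: particle_solution_def)
    show "((\<lambda>t. w t (snd s)) has_vector_derivative
        (\<Sum>r\<in>?S. pmf p r *\<^sub>R K (w t (snd s)) (w t (snd r)))) (at t)" if "s \<in> ?S" for s t
      unfolding sum_index_coupling_snd[OF p MN, of "\<lambda>k. K (w t (snd s)) (w t k)"]
      using w that by (auto simp: particle_solution_def)
  qed (simp_all add: K1 K2 L)
  moreover have "z 0 = x" "w 0 = y" using z w by (auto simp: particle_solution_def)
  ultimately show ?thesis
    using p MN by (simp add: integral_index_coupling case_prod_beta)
qed

lemma particle_solution_unique:
  assumes z: "particle_solution K n x z" and w: "particle_solution K n x w" and n: "0 < n"
  shows "z = w"
proof
  fix t
  have "(1 / real n) * (\<Sum>i<n. norm (z t i - w t i)) \<le> 0"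
    using particle_solution_stability[OF z w diagonal_coupling n n, of t] n
    by (simp add: integral_diagonal_coupling)
  hence "(\<Sum>i<n. norm (z t i - w t i)) \<le> 0"
    using n by (simp add: field_simps)
  hence "(\<Sum>i<n. norm (z t i - w t i)) = 0"
    by (simp add: sum_nonneg order.antisym)
  hence "\<forall>i<n. z t i = w t i" by (simp add: sum_nonneg_eq_0_iff)
  \<comment> \<open>Outside \<open>{..<n}\<close> both are \<open>undefined\<close>, as
    configurations are extensional.\<close>
  thus "z t = w t"
    using z w by (intro PiE_ext[of "z t" "{..<n}" "\<lambda>_. UNIV"])
      (auto simp: particle_solution_def space_configs)
qed

text \<open>The number of particles is a term, not a type, so the Banach space is that of all
  bounded functions on the discrete space of indices. \<open>E\<close> embeds configurations by
  padding with 0 and \<open>c\<close> reads off coordinates. In the supremum norm the vector field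
  has Lipschitz constant \<open>2 * L\<close>, one \<open>L\<close> for each argument of
  \<open>K\<close>.\<close>

lemma ex_particle_solution:
  assumes n: "0 < n" and x: "x \<in> space (configs n)"
  shows "\<exists>z. particle_solution K n x z"
proof -
  define E :: "(nat \<Rightarrow> 'a) \<Rightarrow> nat discrete \<Rightarrow>\<^sub>C 'a" where
    "E y = Bcontfun (\<lambda>k. if of_discrete k < n then y (of_discrete k) else 0)" for y
  define c :: "(nat discrete \<Rightarrow>\<^sub>C 'a) \<Rightarrow> nat \<Rightarrow> 'a" where "c u k = apply_bcontfun u (discrete k)" for u k
  have E: "apply_bcontfun (E y) k = (if of_discrete k < n then y (of_discrete k) else 0)" for y k
    unfolding E_def
  proof (subst Bcontfun_inverse[OF bcontfun_normI[where b = "\<Sum>k<n. norm (y k)"]])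
    show "continuous_on UNIV (\<lambda>k. if of_discrete k < n then y (of_discrete k) else 0)"
      by (simp add: continuous_on_open_vimage open_discrete)
    show "norm (if of_discrete k < n then y (of_discrete k) else 0) \<le> (\<Sum>k<n. norm (y k))" for k
      by (auto intro: member_le_sum sum_nonneg)
  qed simp
  have c_E: "c (E y) k = (if k < n then y k else 0)" for y k
    by (simp add: c_def E discrete_inverse)
  have c_diff: "norm (c u k - c v k) \<le> norm (u - v)" for u v k
    using norm_bounded[of "u - v"] by (simp add: c_def)
  define F where "F u = E (\<lambda>k. (1 / real n) *\<^sub>R (\<Sum>l<n. K (c u k) (c u l)))" for u
  have "norm (F u - F v) \<le> (2 * L) * norm (u - v)" for u v
  proof (rule norm_bound)
    fix d :: "nat discrete"
    define k where "k = of_discrete d"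
    show "norm (apply_bcontfun (F u - F v) d) \<le> (2 * L) * norm (u - v)"
    proof (cases "k < n")
      case True
      have "norm (\<Sum>l<n. K (c u k) (c u l) - K (c v k) (c v l)) \<le> (\<Sum>l<n. 2 * L * norm (u - v))"
      proof (rule sum_norm_le)
        fix l
        have "norm (K (c u k) (c u l) - K (c v k) (c v l))
            \<le> norm (K (c u k) (c u l) - K (c v k) (c u l))
              + norm (K (c v k) (c u l) - K (c v k) (c v l))"
          by (rule norm_diff_triangle_le[OF order_refl order_refl])
        also have "\<dots> \<le> L * norm (u - v) + L * norm (u - v)"
          using L by (intro add_mono order_trans[OF K1] order_trans[OF K2] mult_left_mono c_diff)
        finally show "norm (K (c u k) (c u l) - K (c v k) (c v l)) \<le> 2 * L * norm (u - v)" by simp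
      qed
      hence "norm (\<Sum>l<n. K (c u k) (c u l) - K (c v k) (c v l)) / real n \<le> 2 * L * norm (u - v)"
        using n by (simp add: field_simps)
      thus ?thesis
        using True by (simp add: F_def E k_def sum_subtractf flip: scaleR_diff_right)
    qed (use L in \<open>simp add: F_def E k_def\<close>)
  qed
  then obtain z where z0: "z 0 = E x" and z: "\<And>t. (z has_vector_derivative F (z t)) (at t)"
    using ex_global_solution[of F "2 * L" "E x"] L by auto
  have "particle_solution K n x (\<lambda>t. restrict (c (z t)) {..<n})"
    unfolding particle_solution_def
  proof (intro conjI allI impI)
    show "restrict (c (z 0)) {..<n} = x"
      using x by (auto simp: z0 c_E space_configs PiE_def extensional_def restrict_def fun_eq_iff)
    show "restrict (c (z t)) {..<n} \<in> space (configs n)" for t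
      by (simp add: space_configs)
    fix t k assume k: "k < n"
    have "bounded_linear (\<lambda>u. c u k)"
      by (rule bounded_linear_intro[where K = 1]) (auto simp: c_def norm_bounded)
    from bounded_linear.has_vector_derivative[OF this z[of t]]
    show "((\<lambda>s. restrict (c (z s)) {..<n} k) has_vector_derivative
        (1 / real n) *\<^sub>R (\<Sum>l<n. K (restrict (c (z t)) {..<n} k) (restrict (c (z t)) {..<n} l))) (at t)"
      using k by (simp add: F_def c_E)
  qed
  thus ?thesis by blast
qed

lemma particle_flow_eq:
  assumes "particle_solution K n x z" "0 < n"
  shows "particle_flow K n t x = z t"
proof -
  have "(THE z. particle_solution K n x z) = z"
    using assms particle_solution_unique by blast
  thus ?thesis by (simp add: particle_flow_def)
qed

lemma particle_solution_flow:
  assumes "x \<in> space (configs n)" "0 < n"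
  shows "particle_solution K n x (\<lambda>t. particle_flow K n t x)"
  using ex_particle_solution[OF assms(2,1)] particle_flow_eq[OF _ assms(2)] by auto

lemma particle_flow_in_space:
  assumes "x \<in> space (configs n)" "0 < n"
  shows "particle_flow K n t x \<in> space (configs n)"
  using particle_solution_flow[OF assms] by (simp add: particle_solution_def)

text \<open>The force is a sum over all particles, so relabelling a solution yields a solution, and
  uniqueness identifies it with the flow. This is what preserves symmetry of the law in
  time.\<close>

lemma particle_flow_permute:
  assumes \<sigma>: "\<sigma> permutes {..<n}" and x: "x \<in> space (configs n)" and n: "0 < n"
  shows "particle_flow K n t (permute_config n \<sigma> x) = permute_config n \<sigma> (particle_flow K n t x)"
proof (rule particle_flow_eq[OF _ n])
  note z = particle_solution_flow[OF x n, unfolded particle_solution_def]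
  have \<sigma>_less: "\<sigma> i < n" if "i < n" for i using permutes_in_image[OF \<sigma>, of i] that by simp
  show "particle_solution K n (permute_config n \<sigma> x) (\<lambda>t. permute_config n \<sigma> (particle_flow K n t x))"
    unfolding particle_solution_def
  proof safe
    show "permute_config n \<sigma> (particle_flow K n 0 x) = permute_config n \<sigma> x"
      using z by simp
    show "permute_config n \<sigma> (particle_flow K n t x) \<in> space (configs n)" for t
      by (simp add: permute_config_def space_configs)
    fix t k assume k: "k < n"
    have "(\<Sum>l<n. K (particle_flow K n t x (\<sigma> k)) (particle_flow K n t x (\<sigma> l)))
        = (\<Sum>l<n. K (particle_flow K n t x (\<sigma> k)) (particle_flow K n t x l))"
      by (subst (2) sum.permute[OF \<sigma>]) (simp add: o_def)
    hence "((\<lambda>s. particle_flow K n s x (\<sigma> k)) has_vector_derivative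
        (1 / real n) *\<^sub>R (\<Sum>l<n. K (particle_flow K n t x (\<sigma> k)) (particle_flow K n t x (\<sigma> l)))) (at t)"
      using z \<sigma>_less[OF k] by simp
    thus "((\<lambda>s. permute_config n \<sigma> (particle_flow K n s x) k) has_vector_derivative
        (1 / real n) *\<^sub>R (\<Sum>l<n. K (permute_config n \<sigma> (particle_flow K n t x) k)
          (permute_config n \<sigma> (particle_flow K n t x) l))) (at t)"
      using k by (simp add: permute_config_def)
  qed
qed

text \<open>Every coordinate of the flow is Lipschitz in the initial configuration, by the stability
  estimate for the diagonal coupling; the factors \<open>1 / n\<close> cancel.\<close>

lemma measurable_particle_flow:
  assumes n: "0 < n"
  shows "particle_flow K n t \<in> measurable (configs n) (configs n)"
proof (rule measurable_PiM_single')
  show "(\<lambda>x. particle_flow K n t x i) \<in> borel_measurable (configs n)" if i: "i \<in> {..<n}" for i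
  proof (rule borel_measurable_configsI)
    fix x y :: "nat \<Rightarrow> 'a" assume xy: "x \<in> space (configs n)" "y \<in> space (configs n)"
    have "norm (particle_flow K n t x i - particle_flow K n t y i)
        \<le> (\<Sum>i<n. norm (particle_flow K n t x i - particle_flow K n t y i))"
      using i by (intro member_le_sum) auto
    also have "\<dots> \<le> exp (2 * L * \<bar>t\<bar>) * (\<Sum>i<n. norm (x i - y i))"
      using particle_solution_stability[OF particle_solution_flow[OF xy(1) n]
          particle_solution_flow[OF xy(2) n] diagonal_coupling n n, of t] n
      by (simp add: integral_diagonal_coupling field_simps)
    finally show "dist (particle_flow K n t x i) (particle_flow K n t y i)
        \<le> exp (2 * L * \<bar>t\<bar>) * (\<Sum>i<n. norm (x i - y i))"
      by (simp add: dist_norm)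
  qed
  show "particle_flow K n t \<in> space (configs n) \<rightarrow> {..<n} \<rightarrow>\<^sub>E space borel"
    using particle_flow_in_space[OF _ n] by (auto simp: space_configs)
qed

end

section \<open>Transport distances along the flow\<close>

text \<open>The integrand of \<^const>\<open>Dist_MK1\<close> need not be shown measurable: the integral is the lower one,
  for which the following inequalities hold for every integrand.\<close>

lemma nn_integral_distr_le:
  assumes T: "T \<in> measurable M N"
  shows "(\<integral>\<^sup>+ x. f x \<partial>distr M N T) \<le> (\<integral>\<^sup>+ x. f (T x) \<partial>M)"
  unfolding nn_integral_def[of "distr M N T"]
proof (rule SUP_least)
  fix g assume "g \<in> {g. simple_function (distr M N T) g \<and> g \<le> f}"
  hence g: "simple_function (distr M N T) g" "g \<le> f" by auto
  have "integral\<^sup>S (distr M N T) g = (\<integral>\<^sup>+ x. g x \<partial>distr M N T)"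
    using g by (simp add: nn_integral_eq_simple_integral)
  \<comment> \<open>Only the simple minorant \<open>g\<close> has to be measurable for the change of
    variables.\<close>
  also have "\<dots> = (\<integral>\<^sup>+ x. g (T x) \<partial>M)"
    using g(1) by (intro nn_integral_distr T borel_measurable_simple_function)
  also have "\<dots> \<le> (\<integral>\<^sup>+ x. f (T x) \<partial>M)"
    using g(2) by (intro nn_integral_mono) (auto simp: le_fun_def)
  finally show "integral\<^sup>S (distr M N T) g \<le> (\<integral>\<^sup>+ x. f (T x) \<partial>M)" .
qed

lemma ennreal_inverse_cancel:
  assumes "0 < c"
  shows "ennreal (1 / c) * (ennreal c * x) = x" "ennreal c * (ennreal (1 / c) * x) = x"
  using assms by (simp_all add: ennreal_mult'[symmetric] mult.assoc[symmetric])

lemma nn_integral_cmult_le: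
  assumes c: "0 \<le> c"
  shows "(\<integral>\<^sup>+ x. ennreal c * f x \<partial>M) \<le> ennreal c * (\<integral>\<^sup>+ x. f x \<partial>M)"
proof (cases "c = 0")
  case False
  with c have c: "0 < c" by simp
  show ?thesis
    unfolding nn_integral_def[of M "\<lambda>x. ennreal c * f x"]
  proof (rule SUP_least)
    fix g assume "g \<in> {g. simple_function M g \<and> g \<le> (\<lambda>x. ennreal c * f x)}"
    hence g: "simple_function M g" "\<And>x. g x \<le> ennreal c * f x" by (auto simp: le_fun_def)
    have [measurable]: "g \<in> borel_measurable M" using g(1) by (rule borel_measurable_simple_function)
    \<comment> \<open>Dividing by \<open>c\<close> turns a minorant of \<open>c * f\<close> into a
      minorant of \<open>f\<close>.\<close>
    have "integral\<^sup>S M g = (\<integral>\<^sup>+ x. ennreal c * (ennreal (1 / c) * g x) \<partial>M)"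
      using g by (simp add: nn_integral_eq_simple_integral ennreal_inverse_cancel[OF c])
    also have "\<dots> = ennreal c * (\<integral>\<^sup>+ x. ennreal (1 / c) * g x \<partial>M)"
      by (rule nn_integral_cmult) measurable
    also have "\<dots> \<le> ennreal c * (\<integral>\<^sup>+ x. f x \<partial>M)"
    proof (intro mult_left_mono nn_integral_mono)
      fix x
      have "ennreal (1 / c) * g x \<le> ennreal (1 / c) * (ennreal c * f x)"
        by (intro mult_left_mono g) simp
      thus "ennreal (1 / c) * g x \<le> f x" by (simp add: ennreal_inverse_cancel[OF c])
    qed simp
    finally show "integral\<^sup>S M g \<le> ennreal c * (\<integral>\<^sup>+ x. f x \<partial>M)" .
  qed
qed simp

text \<open>For \<open>c > 0\<close> one divides by \<open>c\<close>. For \<open>c = 0\<close> the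
  index set must be nonempty: the infimum over the empty set is \<open>top\<close>, and
  \<open>0 * top = 0\<close>.\<close>

lemma le_cmult_INF_ennreal:
  fixes f :: "'b \<Rightarrow> ennreal"
  assumes c: "0 \<le> c" "c = 0 \<Longrightarrow> I \<noteq> {}" and le: "\<And>i. i \<in> I \<Longrightarrow> a \<le> ennreal c * f i"
  shows "a \<le> ennreal c * (INF i\<in>I. f i)"
proof (cases "c = 0")
  case True
  thus ?thesis using c(2) le by fastforce
next
  case False
  with c have c: "0 < c" by simp
  have "ennreal (1 / c) * a \<le> (INF i\<in>I. f i)"
  proof (rule INF_greatest)
    fix i assume "i \<in> I"
    hence "ennreal (1 / c) * a \<le> ennreal (1 / c) * (ennreal c * f i)"
      by (intro mult_left_mono le) simp_all
    thus "ennreal (1 / c) * a \<le> f i" by (simp add: ennreal_inverse_cancel[OF c])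
  qed
  hence "ennreal c * (ennreal (1 / c) * a) \<le> ennreal c * (INF i\<in>I. f i)"
    by (intro mult_left_mono) simp_all
  thus ?thesis by (simp add: ennreal_inverse_cancel[OF c])
qed

section \<open>Empirical measures and their couplings\<close>

lemma couplings_nonempty:
  assumes "prob_space \<mu>" "prob_space \<nu>"
  shows "couplings \<mu> \<nu> \<noteq> {}"
proof -
  interpret \<mu>: prob_space \<mu> by fact
  interpret \<nu>: prob_space \<nu> by fact
  interpret pair_prob_space \<mu> \<nu> ..
  have "distr (\<mu> \<Otimes>\<^sub>M \<nu>) \<nu> snd = \<nu>"
  proof (rule measure_eqI)
    fix A assume "A \<in> sets (distr (\<mu> \<Otimes>\<^sub>M \<nu>) \<nu> snd)"
    hence A: "A \<in> sets \<nu>" by simp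
    hence "emeasure (distr (\<mu> \<Otimes>\<^sub>M \<nu>) \<nu> snd) A = emeasure (\<mu> \<Otimes>\<^sub>M \<nu>) (space \<mu> \<times> A)"
      using sets.sets_into_space[OF A]
      by (subst emeasure_distr) (auto intro!: arg_cong[where f = "emeasure _"] simp: space_pair_measure)
    thus "emeasure (distr (\<mu> \<Otimes>\<^sub>M \<nu>) \<nu> snd) A = emeasure \<nu> A"
      using A by (simp add: \<nu>.emeasure_pair_measure_Times \<mu>.emeasure_space_1)
  qed simp
  hence "\<mu> \<Otimes>\<^sub>M \<nu> \<in> couplings \<mu> \<nu>"
    by (simp add: couplings_def \<nu>.distr_pair_fst prob_space_axioms)
  thus ?thesis by blast
qed

text \<open>As the law of \<open>z\<close> at a uniformly random index, the empirical measure is a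
  push-forward, so couplings of indices induce couplings of empirical measures.\<close>

lemma empirical_measure_eq:
  fixes z :: "nat \<Rightarrow> 'a::euclidean_space"
  assumes n: "0 < n"
  shows "empirical_measure n z = distr (measure_pmf (pmf_of_set {..<n})) borel z"
proof -
  let ?D = "distr (measure_pmf (pmf_of_set {..<n})) borel z"
  have "empirical_measure n z = measure_of UNIV (sets borel) (emeasure ?D)"
    unfolding empirical_measure_def
  proof (rule measure_of_eq)
    fix A :: "'a set" assume "A \<in> sigma_sets UNIV (sets borel)"
    hence A: "A \<in> sets borel" using sets.sigma_sets_eq[of "borel :: 'a measure"] by simp
    have "emeasure ?D A = ennreal (real (card ({..<n} \<inter> z -` A)) / real n)"
      using A n by (subst emeasure_distr) (auto simp: emeasure_pmf_of_set lessThan_empty_iff)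
    also have "\<dots> = ennreal (1 / real n) * ennreal (real (card ({..<n} \<inter> z -` A)))"
      by (subst ennreal_mult[symmetric]) auto
    also have "ennreal (real (card ({..<n} \<inter> z -` A))) = (\<Sum>k<n. emeasure (return borel (z k)) A)"
      using A by (simp add: indicator_def sum.If_cases ennreal_of_nat_eq_real_of_nat vimage_def)
    finally show "ennreal (1 / real n) * (\<Sum>k<n. emeasure (return borel (z k)) A) = emeasure ?D A" ..
  qed simp
  also have "\<dots> = ?D"
    using measure_of_of_measure[of ?D] by simp
  finally show ?thesis .
qed

lemma prob_space_empirical_measure:
  fixes z :: "nat \<Rightarrow> 'a::euclidean_space"
  assumes "0 < n"
  shows "prob_space (empirical_measure n z)"
  unfolding empirical_measure_eq[OF assms] by (rule measure_pmf.prob_space_distr) simp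

lemma sets_empirical_measure [simp, measurable_cong]:
  fixes z :: "nat \<Rightarrow> 'a::euclidean_space"
  shows "sets (empirical_measure n z) = sets borel"
  unfolding empirical_measure_def using sets.sigma_sets_eq[of "borel :: 'a measure"] by (simp add: sets_measure_of_conv)

lemma measure_empirical_measure:
  assumes "0 < n" "A \<in> sets borel"
  shows "measure (empirical_measure n z) A = real (card {i\<in>{..<n}. z i \<in> A}) / real n"
  using assms by (simp add: empirical_measure_eq measure_distr measure_pmf_of_set lessThan_empty_iff
      Int_def vimage_def)

text \<open>The image of \<open>p\<close> under \<open>(i, j) \<mapsto> (x i, y j)\<close> is an
  admissible coupling with this cost. Together with \<open>ex_index_coupling\<close> it shows that
  index couplings suffice to compute the distance.\<close>

lemma dist_MK1_empirical_le:
  assumes p: "p \<in> index_couplings M N" and MN: "0 < M" "0 < N"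
  shows "dist_MK1 (empirical_measure M x) (empirical_measure N y)
    \<le> ennreal (measure_pmf.expectation p (\<lambda>(i, j). norm (x i - y j)))"
proof -
  define T where "T = (\<lambda>(i, j). (x i, y j))"
  define \<pi> where "\<pi> = distr (measure_pmf p) (borel \<Otimes>\<^sub>M borel) T"
  have T [measurable]: "T \<in> measurable (measure_pmf p) (borel \<Otimes>\<^sub>M borel)"
    unfolding measurable_pmf_measure1 space_pair_measure by simp
  have x: "distr \<pi> (empirical_measure M x) fst = empirical_measure M x"
  proof -
    have "distr \<pi> (empirical_measure M x) fst = distr \<pi> borel fst"
      by (rule distr_cong) auto
    also have "\<dots> = distr (measure_pmf p) borel (x \<circ> fst)"
      unfolding \<pi>_def by (subst distr_distr[OF _ T]) (simp_all add: T_def o_def case_prod_beta)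
    also have "\<dots> = distr (measure_pmf (map_pmf fst p)) borel x"
      unfolding map_pmf_rep_eq by (subst distr_distr) auto
    also have "\<dots> = empirical_measure M x"
      using p MN by (simp add: empirical_measure_eq index_couplings_def)
    finally show ?thesis .
  qed
  have y: "distr \<pi> (empirical_measure N y) snd = empirical_measure N y"
  proof -
    have "distr \<pi> (empirical_measure N y) snd = distr \<pi> borel snd"
      by (rule distr_cong) auto
    also have "\<dots> = distr (measure_pmf p) borel (y \<circ> snd)"
      unfolding \<pi>_def by (subst distr_distr[OF _ T]) (simp_all add: T_def o_def case_prod_beta)
    also have "\<dots> = distr (measure_pmf (map_pmf snd p)) borel y"
      unfolding map_pmf_rep_eq by (subst distr_distr) auto
    also have "\<dots> = empirical_measure N y"
      using p MN by (simp add: empirical_measure_eq index_couplings_def)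
    finally show ?thesis .
  qed
  have "\<pi> \<in> couplings (empirical_measure M x) (empirical_measure N y)"
    unfolding couplings_def
  proof (safe intro!: x y)
    show "prob_space \<pi>"
      unfolding \<pi>_def by (rule measure_pmf.prob_space_distr) (rule T)
  qed (simp_all add: \<pi>_def cong: sets_pair_measure_cong)
  hence "dist_MK1 (empirical_measure M x) (empirical_measure N y)
      \<le> (\<integral>\<^sup>+ (x, y). ennreal (norm (x - y)) \<partial>\<pi>)"
    unfolding dist_MK1_def by (rule INF_lower)
  also have "\<dots> = (\<integral>\<^sup>+ s. ennreal (case s of (i, j) \<Rightarrow> norm (x i - y j)) \<partial>measure_pmf p)"
    unfolding \<pi>_def by (subst nn_integral_distr[OF T]) (simp_all add: T_def case_prod_beta)
  also have "\<dots> = ennreal (measure_pmf.expectation p (\<lambda>(i, j). norm (x i - y j)))"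
  proof (rule nn_integral_eq_integral)
    have "finite (set_pmf p)"
      using set_pmf_index_coupling[OF p MN] finite_subset by blast
    thus "integrable (measure_pmf p) (\<lambda>(i, j). norm (x i - y j))"
      by (rule integrable_measure_pmf_finite)
  qed auto
  finally show ?thesis .
qed

text \<open>Each value is shared equally among the indices that attain it, so the shares add up to
  one copy per distinct value.\<close>

lemma sum_div_card_fiber:
  fixes g :: "'b \<Rightarrow> real"
  assumes A: "finite A"
  shows "(\<Sum>i\<in>A. g (f i) / real (card {j\<in>A. f j = f i})) = (\<Sum>v\<in>f ` A. g v)"
proof -
  have "(\<Sum>i\<in>A. g (f i) / real (card {j\<in>A. f j = f i}))
      = (\<Sum>v\<in>f ` A. \<Sum>i\<in>{i\<in>A. f i = v}. g (f i) / real (card {j\<in>A. f j = f i}))"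
    by (rule sum.image_gen[OF A])
  also have "\<dots> = (\<Sum>v\<in>f ` A. g v)"
  proof (rule sum.cong[OF refl])
    fix v assume v: "v \<in> f ` A"
    hence "{j\<in>A. f j = v} \<noteq> {}" by auto
    hence "card {j\<in>A. f j = v} > 0" using A by (simp add: card_gt_0_iff)
    thus "(\<Sum>i\<in>{i\<in>A. f i = v}. g (f i) / real (card {j\<in>A. f j = f i})) = g v"
      by simp
  qed
  finally show ?thesis .
qed

lemma
  assumes \<pi>: "\<pi> \<in> couplings \<mu> \<nu>" and sets: "sets \<mu> = sets borel" "sets \<nu> = sets borel"
  shows measure_coupling_fst: "A \<in> sets borel \<Longrightarrow> measure \<pi> (A \<times> UNIV) = measure \<mu> A"
    and measure_coupling_snd: "A \<in> sets borel \<Longrightarrow> measure \<pi> (UNIV \<times> A) = measure \<nu> A"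
proof -
  have sets_\<pi>: "sets \<pi> = sets (\<mu> \<Otimes>\<^sub>M \<nu>)" and *: "distr \<pi> \<mu> fst = \<mu>" "distr \<pi> \<nu> snd = \<nu>"
    using \<pi> by (auto simp: couplings_def)
  have space: "space \<mu> = UNIV" "space \<nu> = UNIV"
    using sets[THEN sets_eq_imp_space_eq] by auto
  have space\<pi>: "space \<pi> = UNIV"
    using sets_eq_imp_space_eq[OF sets_\<pi>] by (simp add: space_pair_measure space)
  have [measurable]: "fst \<in> measurable \<pi> \<mu>" "snd \<in> measurable \<pi> \<nu>"
    by (simp_all add: measurable_cong_sets[OF sets_\<pi> refl])
  have "measure (distr \<pi> \<mu> fst) A = measure \<pi> (A \<times> UNIV)" if "A \<in> sets borel"
    using that by (subst measure_distr) (auto simp: sets space\<pi> vimage_fst)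
  thus "A \<in> sets borel \<Longrightarrow> measure \<pi> (A \<times> UNIV) = measure \<mu> A" by (simp add: *)
  have "measure (distr \<pi> \<nu> snd) A = measure \<pi> (UNIV \<times> A)" if "A \<in> sets borel"
    using that by (subst measure_distr) (auto simp: sets space\<pi> vimage_snd)
  thus "A \<in> sets borel \<Longrightarrow> measure \<pi> (UNIV \<times> A) = measure \<nu> A" by (simp add: *)
qed

lemma pmf_map_finite_support:
  assumes "set_pmf p \<subseteq> S" "finite S"
  shows "pmf (map_pmf f p) y = (\<Sum>s\<in>{s\<in>S. f s = y}. pmf p s)"
proof -
  have "pmf (map_pmf f p) y = measure_pmf.prob p (f -` {y} \<inter> set_pmf p)"
    by (simp add: pmf_map measure_Int_set_pmf)
  also have "f -` {y} \<inter> set_pmf p = {s\<in>S. f s = y} \<inter> set_pmf p" using assms by auto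
  also have "measure_pmf.prob p \<dots> = (\<Sum>s\<in>{s\<in>S. f s = y}. pmf p s)"
    using assms by (simp add: measure_Int_set_pmf measure_measure_pmf_finite)
  finally show ?thesis .
qed

lemma ex_pmf_finite_support:
  fixes a :: "'b \<Rightarrow> real"
  assumes "finite S" "\<And>s. s \<in> S \<Longrightarrow> 0 \<le> a s" "(\<Sum>s\<in>S. a s) = 1"
  obtains p where "set_pmf p \<subseteq> S" "\<And>s. s \<in> S \<Longrightarrow> pmf p s = a s"
proof -
  define b where "b s = (if s \<in> S then a s else 0)" for s
  have nonneg: "0 \<le> b s" for s using assms by (simp add: b_def)
  have "(\<integral>\<^sup>+ s. ennreal (b s) \<partial>count_space UNIV) = (\<Sum>s\<in>S. ennreal (b s))"
    using assms by (intro nn_integral_count_space') (auto simp: b_def)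
  also have "\<dots> = ennreal (\<Sum>s\<in>S. b s)" using nonneg by (intro sum_ennreal)
  also have "(\<Sum>s\<in>S. b s) = 1" using assms by (simp add: b_def)
  finally have "(\<integral>\<^sup>+ s. ennreal (b s) \<partial>count_space UNIV) = 1" by simp
  note p = pmf_embed_pmf[of b, OF nonneg this]
  show ?thesis
    by (rule that[of "embed_pmf b"]) (auto simp: set_pmf_eq p b_def split: if_splits)
qed

text \<open>A coupling \<open>\<pi>\<close> of two empirical measures lives on the finitely many pairs \<open>(x\<^sub>i, y\<^sub>j)\<close>; the mass
  of a pair is shared equally among all index pairs that represent it.\<close>

lemma ex_index_coupling:
  fixes x y :: "nat \<Rightarrow> 'a::euclidean_space"
  assumes \<pi>: "\<pi> \<in> couplings (empirical_measure M x) (empirical_measure N y)" and MN: "0 < M" "0 < N"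
  shows "\<exists>p\<in>index_couplings M N. ennreal (measure_pmf.expectation p (\<lambda>(i, j). norm (x i - y j)))
    \<le> (\<integral>\<^sup>+ (x, y). ennreal (norm (x - y)) \<partial>\<pi>)"
proof -
  define \<mu> \<nu> where "\<mu> = empirical_measure M x" and "\<nu> = empirical_measure N y"
  define U V where "U = x ` {..<M}" and "V = y ` {..<N}"
  define c d where "c i = real (card {k\<in>{..<M}. x k = x i})"
    and "d j = real (card {l\<in>{..<N}. y l = y j})" for i j
  define q where "q u v = measure \<pi> {(u, v)}" for u v
  \<comment> \<open>\<open>c i * d j\<close> is the number of index pairs that represent the point
    \<open>(x i, y j)\<close>.\<close>
  define a where "a = (\<lambda>(i, j). q (x i) (y j) / (c i * d j))"
  let ?S = "{..<M} \<times> {..<N}"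
  have finite: "finite U" "finite V" by (auto simp: U_def V_def)
  have \<pi>': "\<pi> \<in> couplings \<mu> \<nu>" and sets: "sets \<mu> = sets borel" "sets \<nu> = sets borel"
    using \<pi> by (auto simp: \<mu>_def \<nu>_def)
  interpret \<pi>: prob_space \<pi> using \<pi> by (simp add: couplings_def)
  have sets_\<pi>: "sets \<pi> = sets borel"
  proof -
    have "sets \<pi> = sets (\<mu> \<Otimes>\<^sub>M \<nu>)" using \<pi>' by (simp add: couplings_def)
    also have "\<dots> = sets (borel \<Otimes>\<^sub>M borel)" using sets by (rule sets_pair_measure_cong)
    finally show ?thesis unfolding borel_prod .
  qed
  have in_sets: "A \<in> sets \<pi>" if "closed A" for A
    using that by (simp add: sets_\<pi>)
  have UV: "U \<in> sets borel" "V \<in> sets borel" "- U \<in> sets borel" "- V \<in> sets borel"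
    using finite by (auto intro: borel_comp borel_closed finite_imp_closed)
  have rect: "A \<times> B \<in> sets \<pi>" if "A \<in> sets borel" "B \<in> sets borel" for A B
    using pair_measureI[OF that] unfolding sets_\<pi> borel_prod .
  have c_pos: "0 < c i" if "i < M" for i
    using that by (auto simp: c_def card_gt_0_iff)
  have d_pos: "0 < d j" if "j < N" for j
    using that by (auto simp: d_def card_gt_0_iff)
  \<comment> \<open>An empirical measure charges nothing outside its points. Hence, in
    \<open>sum_V\<close> and \<open>sum_U\<close>, enlarging \<open>V\<close> or \<open>U\<close> to
    the whole space adds no mass.\<close>
  have null_U: "measure \<pi> ((- U) \<times> UNIV) = 0"
    using measure_coupling_fst[OF \<pi>' sets UV(3)] measure_empirical_measure[OF MN(1) UV(3), of x]
    by (simp add: \<mu>_def U_def)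
  have null_V: "measure \<pi> (UNIV \<times> (- V)) = 0"
    using measure_coupling_snd[OF \<pi>' sets UV(4)] measure_empirical_measure[OF MN(2) UV(4), of y]
    by (simp add: \<nu>_def V_def)
  have sum_V: "(\<Sum>v\<in>V. q (x i) v) = c i / real M" if "i < M" for i
  proof -
    have "(\<Sum>v\<in>V. q (x i) v) = (\<Sum>s\<in>{x i} \<times> V. measure \<pi> {s})"
      by (simp add: q_def sum.cartesian_product')
    also have "\<dots> = measure \<pi> ({x i} \<times> V)"
      using finite by (intro \<pi>.finite_measure_eq_sum_singleton[symmetric] in_sets) auto
    also have "\<dots> = measure \<pi> ({x i} \<times> UNIV)"
    proof (rule antisym)
      show "measure \<pi> ({x i} \<times> V) \<le> measure \<pi> ({x i} \<times> UNIV)"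
        by (intro \<pi>.finite_measure_mono rect) auto
      have "measure \<pi> ({x i} \<times> UNIV) \<le> measure \<pi> ({x i} \<times> V \<union> UNIV \<times> (- V))"
        by (intro \<pi>.finite_measure_mono sets.Un rect) (auto simp: UV)
      also have "\<dots> \<le> measure \<pi> ({x i} \<times> V) + measure \<pi> (UNIV \<times> (- V))"
        by (intro measure_Un_le rect) (auto simp: UV)
      finally show "measure \<pi> ({x i} \<times> UNIV) \<le> measure \<pi> ({x i} \<times> V)" by (simp add: null_V)
    qed
    also have "\<dots> = c i / real M"
      using measure_coupling_fst[OF \<pi>' sets, of "{x i}"] MN
      by (simp add: \<mu>_def measure_empirical_measure c_def)
    finally show ?thesis .
  qed
  have sum_U: "(\<Sum>u\<in>U. q u (y j)) = d j / real N" if "j < N" for j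
  proof -
    have "(\<Sum>u\<in>U. q u (y j)) = (\<Sum>s\<in>U \<times> {y j}. measure \<pi> {s})"
      by (simp add: q_def sum.cartesian_product')
    also have "\<dots> = measure \<pi> (U \<times> {y j})"
      using finite by (intro \<pi>.finite_measure_eq_sum_singleton[symmetric] in_sets) auto
    also have "\<dots> = measure \<pi> (UNIV \<times> {y j})"
    proof (rule antisym)
      show "measure \<pi> (U \<times> {y j}) \<le> measure \<pi> (UNIV \<times> {y j})"
        by (intro \<pi>.finite_measure_mono rect) auto
      have "measure \<pi> (UNIV \<times> {y j}) \<le> measure \<pi> (U \<times> {y j} \<union> (- U) \<times> UNIV)"
        by (intro \<pi>.finite_measure_mono sets.Un rect) (auto simp: UV)
      also have "\<dots> \<le> measure \<pi> (U \<times> {y j}) + measure \<pi> ((- U) \<times> UNIV)"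
        by (intro measure_Un_le rect) (auto simp: UV)
      finally show "measure \<pi> (UNIV \<times> {y j}) \<le> measure \<pi> (U \<times> {y j})" by (simp add: null_U)
    qed
    also have "\<dots> = d j / real N"
      using measure_coupling_snd[OF \<pi>' sets, of "{y j}"] MN
      by (simp add: \<nu>_def measure_empirical_measure d_def)
    finally show ?thesis .
  qed
  \<comment> \<open>The atom at \<open>x i\<close> has mass \<open>c i / M\<close> and is shared by
    \<open>c i\<close> indices, so each index receives \<open>1 / M\<close>.\<close>
  have row: "(\<Sum>j<N. a (i, j)) = 1 / real M" if "i < M" for i
  proof -
    have "(\<Sum>j<N. a (i, j)) = (\<Sum>j<N. q (x i) (y j) / d j) / c i"
      by (simp add: a_def sum_divide_distrib mult.commute)
    also have "(\<Sum>j<N. q (x i) (y j) / d j) = (\<Sum>v\<in>V. q (x i) v)"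
      unfolding d_def V_def by (rule sum_div_card_fiber) simp
    finally show ?thesis using sum_V[OF that] c_pos[OF that] by simp
  qed
  have col: "(\<Sum>i<M. a (i, j)) = 1 / real N" if "j < N" for j
  proof -
    have "(\<Sum>i<M. a (i, j)) = (\<Sum>i<M. q (x i) (y j) / c i) / d j"
      by (simp add: a_def sum_divide_distrib)
    also have "(\<Sum>i<M. q (x i) (y j) / c i) = (\<Sum>u\<in>U. q u (y j))"
      unfolding c_def U_def by (rule sum_div_card_fiber) simp
    finally show ?thesis using sum_U[OF that] d_pos[OF that] by simp
  qed
  have "(\<Sum>s\<in>?S. a s) = (\<Sum>i<M. \<Sum>j<N. a (i, j))"
    by (simp add: sum.cartesian_product)
  also have "\<dots> = 1" using row MN by simp
  finally have "(\<Sum>s\<in>?S. a s) = 1" .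
  moreover have "0 \<le> a s" for s
    by (simp add: a_def q_def c_def d_def split: prod.split)
  ultimately obtain p where p: "set_pmf p \<subseteq> ?S" "\<And>s. s \<in> ?S \<Longrightarrow> pmf p s = a s"
    using ex_pmf_finite_support[of ?S a] by blast
  have "p \<in> index_couplings M N"
    unfolding index_couplings_def
  proof (intro CollectI conjI pmf_eqI)
    fix i
    have "{s \<in> ?S. fst s = i} = (if i < M then {i} \<times> {..<N} else {})" by auto
    moreover have "(\<Sum>s\<in>{i} \<times> {..<N}. pmf p s) = 1 / real M" if "i < M"
      using row[OF that] that by (simp add: p(2) sum.cartesian_product')
    ultimately show "pmf (map_pmf fst p) i = pmf (pmf_of_set {..<M}) i"
      using MN by (subst pmf_map_finite_support[OF p(1)]) (auto simp: lessThan_empty_iff)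
  next
    fix j
    have "{s \<in> ?S. snd s = j} = (if j < N then {..<M} \<times> {j} else {})" by auto
    moreover have "(\<Sum>s\<in>{..<M} \<times> {j}. pmf p s) = 1 / real N" if "j < N"
      using col[OF that] that by (simp add: p(2) sum.cartesian_product')
    ultimately show "pmf (map_pmf snd p) j = pmf (pmf_of_set {..<N}) j"
      using MN by (subst pmf_map_finite_support[OF p(1)]) (auto simp: lessThan_empty_iff)
  qed
  moreover have "ennreal (measure_pmf.expectation p (\<lambda>(i, j). norm (x i - y j)))
      \<le> (\<integral>\<^sup>+ (x, y). ennreal (norm (x - y)) \<partial>\<pi>)"
  proof -
    have "measure_pmf.expectation p (\<lambda>(i, j). norm (x i - y j))
        = (\<Sum>(i, j)\<in>?S. a (i, j) * norm (x i - y j))"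
      using p by (subst integral_measure_pmf[of ?S]) (auto intro!: sum.cong)
    also have "\<dots> = (\<Sum>i<M. (\<Sum>j<N. q (x i) (y j) * norm (x i - y j) / d j) / c i)"
      by (simp add: sum.cartesian_product' a_def sum_divide_distrib mult_ac)
    also have "\<dots> = (\<Sum>i<M. (\<Sum>v\<in>V. q (x i) v * norm (x i - v)) / c i)"
      unfolding d_def V_def
      by (intro sum.cong arg_cong2[where f = "(/)"] refl
          sum_div_card_fiber[where g = "\<lambda>v. q (x i) v * norm (x i - v)" for i]) simp
    also have "\<dots> = (\<Sum>u\<in>U. \<Sum>v\<in>V. q u v * norm (u - v))"
      unfolding c_def U_def
      by (rule sum_div_card_fiber[where g = "\<lambda>u. \<Sum>v\<in>V. q u v * norm (u - v)"]) simp
    also have "\<dots> = (\<Sum>s\<in>U \<times> V. norm (fst s - snd s) * measure \<pi> {s})"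
      by (simp add: sum.cartesian_product q_def case_prod_beta mult.commute)
    finally have "ennreal (measure_pmf.expectation p (\<lambda>(i, j). norm (x i - y j)))
        = (\<Sum>s\<in>U \<times> V. ennreal (norm (fst s - snd s)) * emeasure \<pi> {s})"
      by (simp add: \<pi>.emeasure_eq_measure flip: sum_ennreal ennreal_mult)
    also have "\<dots> = (\<integral>\<^sup>+ z. (\<Sum>s\<in>U \<times> V. ennreal (norm (fst s - snd s)) * indicator {s} z) \<partial>\<pi>)"
      by (subst nn_integral_sum) (auto intro!: in_sets sum.cong nn_integral_cmult_indicator[symmetric]
          borel_measurable_times_ennreal borel_measurable_indicator)
    \<comment> \<open>Keeping only the atoms in \<open>U \<times> V\<close> gives a pointwise
      minorant of the cost, and only this direction is wanted.\<close>
    also have "\<dots> \<le> (\<integral>\<^sup>+ (x, y). ennreal (norm (x - y)) \<partial>\<pi>)"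
    proof (rule nn_integral_mono)
      fix z
      have "(\<Sum>s\<in>U \<times> V. ennreal (norm (fst s - snd s)) * indicator {s} z)
          = (\<Sum>s\<in>U \<times> V. if s = z then ennreal (norm (fst s - snd s)) else 0)"
        by (intro sum.cong) (auto simp: indicator_def)
      also have "\<dots> \<le> ennreal (norm (fst z - snd z))"
        using finite by (simp add: sum.delta)
      finally show "(\<Sum>s\<in>U \<times> V. ennreal (norm (fst s - snd s)) * indicator {s} z)
          \<le> (case z of (x, y) \<Rightarrow> ennreal (norm (x - y)))"
        by (simp add: case_prod_beta)
    qed
    finally show ?thesis .
  qed
  ultimately show ?thesis by blast
qed

text \<open>Each coupling of the empirical measures costs at least as much as some index coupling,
  so bounds need checking on index couplings only. Both (a) and (b) reach \<open>dist_MK1\<close>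
  this way.\<close>

lemma le_cmult_dist_MK1_empiricalI:
  assumes "0 < M" "0 < N" and C: "0 \<le> C"
    and le: "\<And>p. p \<in> index_couplings M N \<Longrightarrow>
      b \<le> ennreal (C * measure_pmf.expectation p (\<lambda>(i, j). norm (x i - y j)))"
  shows "b \<le> ennreal C * dist_MK1 (empirical_measure M x) (empirical_measure N y)"
  unfolding dist_MK1_def
proof (rule le_cmult_INF_ennreal[OF C couplings_nonempty])
  fix \<pi> assume "\<pi> \<in> couplings (empirical_measure M x) (empirical_measure N y)"
  then obtain p where p: "p \<in> index_couplings M N"
    and p_le: "ennreal (measure_pmf.expectation p (\<lambda>(i, j). norm (x i - y j)))
      \<le> (\<integral>\<^sup>+ (x, y). ennreal (norm (x - y)) \<partial>\<pi>)"
    using ex_index_coupling assms by blast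
  have "b \<le> ennreal C * ennreal (measure_pmf.expectation p (\<lambda>(i, j). norm (x i - y j)))"
    using le[OF p] C by (simp add: ennreal_mult')
  also have "\<dots> \<le> ennreal C * (\<integral>\<^sup>+ (x, y). ennreal (norm (x - y)) \<partial>\<pi>)"
    using p_le by (rule mult_left_mono) simp
  finally show "b \<le> ennreal C * (\<integral>\<^sup>+ (x, y). ennreal (norm (x - y)) \<partial>\<pi>)" .
qed (simp_all add: prob_space_empirical_measure assms)

context lipschitz_interaction
begin

text \<open>The index coupling is kept fixed while the particles move: \<open>p\<close> bounds the
  distance at time \<open>t\<close>, and being arbitrary it yields the infimum at time 0.\<close>

lemma dist_MK1_flow_le:
  assumes "x \<in> space (configs M)" "y \<in> space (configs N)" and MN: "0 < M" "0 < N"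
  shows "dist_MK1 (empirical_measure M (particle_flow K M t x)) (empirical_measure N (particle_flow K N t y))
    \<le> ennreal (exp (2 * L * \<bar>t\<bar>)) * dist_MK1 (empirical_measure M x) (empirical_measure N y)"
proof (rule le_cmult_dist_MK1_empiricalI[OF MN])
  fix p assume p: "p \<in> index_couplings M N"
  have "dist_MK1 (empirical_measure M (particle_flow K M t x)) (empirical_measure N (particle_flow K N t y))
      \<le> ennreal (measure_pmf.expectation p (\<lambda>(i, j). norm (particle_flow K M t x i - particle_flow K N t y j)))"
    by (rule dist_MK1_empirical_le[OF p MN])
  also have "\<dots> \<le> ennreal (exp (2 * L * \<bar>t\<bar>) * measure_pmf.expectation p (\<lambda>(i, j). norm (x i - y j)))"
    by (intro ennreal_leI particle_solution_stability[OF _ _ p MN] particle_solution_flow assms)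
  finally show "dist_MK1 (empirical_measure M (particle_flow K M t x)) (empirical_measure N (particle_flow K N t y))
      \<le> ennreal (exp (2 * L * \<bar>t\<bar>) * measure_pmf.expectation p (\<lambda>(i, j). norm (x i - y j)))" .
qed simp

text \<open>Push-forward under a product map commutes with taking marginals.\<close>

lemma evolve_coupling:
  assumes P: "sets P = sets (configs M)" and Q: "sets Q = sets (configs N)"
    and \<rho>: "\<rho> \<in> couplings P Q" and MN: "0 < M" "0 < N"
  shows "distr \<rho> (configs M \<Otimes>\<^sub>M configs N) (map_prod (particle_flow K M t) (particle_flow K N t))
    \<in> couplings (evolve K M t P) (evolve K N t Q)"
    and "map_prod (particle_flow K M t) (particle_flow K N t) \<in> measurable \<rho> (configs M \<Otimes>\<^sub>M configs N)"
proof -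
  interpret \<rho>: prob_space \<rho> using \<rho> by (simp add: couplings_def)
  have sets_\<rho>: "sets \<rho> = sets (configs M \<Otimes>\<^sub>M configs N)"
    using \<rho> sets_pair_measure_cong[OF P Q] by (simp add: couplings_def)
  note [measurable] = measurable_particle_flow[OF MN(1)] measurable_particle_flow[OF MN(2)]
  note [measurable_cong] = P Q sets_\<rho>
  let ?T = "map_prod (particle_flow K M t) (particle_flow K N t)"
  have T': "?T = (\<lambda>s. (particle_flow K M t (fst s), particle_flow K N t (snd s)))"
    by (auto simp: map_prod_def)
  show T [measurable]: "?T \<in> measurable \<rho> (configs M \<Otimes>\<^sub>M configs N)"
    unfolding T' by measurable
  define \<rho>' where "\<rho>' = distr \<rho> (configs M \<Otimes>\<^sub>M configs N) ?T"
  have "distr \<rho>' (evolve K M t P) fst = distr \<rho>' (configs M) fst"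
    by (rule distr_cong) (auto simp: evolve_def)
  also have "\<dots> = distr \<rho> (configs M) (particle_flow K M t \<circ> fst)"
    unfolding \<rho>'_def by (subst distr_distr) (auto simp: T' o_def)
  also have "\<dots> = distr (distr \<rho> P fst) (configs M) (particle_flow K M t)"
    by (subst distr_distr) auto
  also have "\<dots> = evolve K M t P"
    using \<rho> by (simp add: couplings_def evolve_def)
  finally have fst: "distr \<rho>' (evolve K M t P) fst = evolve K M t P" .
  have "distr \<rho>' (evolve K N t Q) snd = distr \<rho>' (configs N) snd"
    by (rule distr_cong) (auto simp: evolve_def)
  also have "\<dots> = distr \<rho> (configs N) (particle_flow K N t \<circ> snd)"
    unfolding \<rho>'_def by (subst distr_distr) (auto simp: T' o_def)
  also have "\<dots> = distr (distr \<rho> Q snd) (configs N) (particle_flow K N t)"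
    by (subst distr_distr) auto
  also have "\<dots> = evolve K N t Q"
    using \<rho> by (simp add: couplings_def evolve_def)
  finally have snd: "distr \<rho>' (evolve K N t Q) snd = evolve K N t Q" .
  have "sets \<rho>' = sets (evolve K M t P \<Otimes>\<^sub>M evolve K N t Q)"
    by (simp add: \<rho>'_def evolve_def cong: sets_pair_measure_cong)
  moreover have "prob_space \<rho>'"
    unfolding \<rho>'_def by (rule \<rho>.prob_space_distr) (rule T)
  ultimately show "\<rho>' \<in> couplings (evolve K M t P) (evolve K N t Q)"
    using fst snd by (simp add: couplings_def)
qed

lemma Dist_MK1_evolve_le:
  assumes P: "sets P = sets (configs M)" and Q: "sets Q = sets (configs N)" and MN: "0 < M" "0 < N"
  shows "Dist_MK1 M N (evolve K M t P) (evolve K N t Q)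
    \<le> ennreal (exp (2 * L * \<bar>t\<bar>)) * Dist_MK1 M N P Q"
  unfolding Dist_MK1_def[of M N P]
proof (rule le_cmult_INF_ennreal)
  fix \<rho> assume \<rho>: "\<rho> \<in> couplings P Q"
  let ?c = "ennreal (exp (2 * L * \<bar>t\<bar>))"
  let ?d = "\<lambda>(X, Y). dist_MK1 (empirical_measure M X) (empirical_measure N Y)"
  let ?T = "map_prod (particle_flow K M t) (particle_flow K N t)"
  have "sets \<rho> = sets (configs M \<Otimes>\<^sub>M configs N)"
    using \<rho> sets_pair_measure_cong[OF P Q] by (simp add: couplings_def)
  from sets_eq_imp_space_eq[OF this]
  have space: "space \<rho> = space (configs M) \<times> space (configs N)"
    by (simp add: space_pair_measure)
  have "Dist_MK1 M N (evolve K M t P) (evolve K N t Q)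
      \<le> (\<integral>\<^sup>+ s. ?d s \<partial>distr \<rho> (configs M \<Otimes>\<^sub>M configs N) ?T)"
    unfolding Dist_MK1_def by (rule INF_lower) (rule evolve_coupling[OF P Q \<rho> MN])
  also have "\<dots> \<le> (\<integral>\<^sup>+ s. ?d (?T s) \<partial>\<rho>)"
    by (rule nn_integral_distr_le) (rule evolve_coupling[OF P Q \<rho> MN])
  also have "\<dots> \<le> (\<integral>\<^sup>+ s. ?c * ?d s \<partial>\<rho>)"
    using dist_MK1_flow_le[OF _ _ MN, of _ _ t] by (intro nn_integral_mono) (auto simp: space)
  also have "\<dots> \<le> ?c * (\<integral>\<^sup>+ s. ?d s \<partial>\<rho>)"
    by (rule nn_integral_cmult_le) simp
  finally show "Dist_MK1 M N (evolve K M t P) (evolve K N t Q) \<le> ?c * (\<integral>\<^sup>+ s. ?d s \<partial>\<rho>)" .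
qed simp_all

end

section \<open>Marginals of symmetric measures\<close>

text \<open>The birthday bound with denominators cleared. In the induction, a non-injective function
  on \<open>Suc m\<close> points either is already non-injective on the first \<open>m\<close>, with
  \<open>M\<close> choices for the last value, or its last value repeats one of at most
  \<open>m\<close> earlier ones.\<close>

lemma card_not_inj_on_le:
  assumes "0 < M"
  shows "2 * real M * real (card {f \<in> {..<m} \<rightarrow>\<^sub>E {..<M}. \<not> inj_on f {..<m}})
    \<le> real m * (real m - 1) * real M ^ m"
proof (induction m)
  case (Suc m)
  let ?E = "\<lambda>m. {..<m} \<rightarrow>\<^sub>E {..<M}"
  let ?B = "\<lambda>m. {f \<in> ?E m. \<not> inj_on f {..<m}}"
  \<comment> \<open>A function on the first \<open>m\<close> points together with a last value that
    it already takes.\<close>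
  let ?C = "SIGMA g : ?E m. g ` {..<m}"
  have fin: "finite (?E m)" by (intro finite_PiE) auto
  have "?B (Suc m) \<subseteq> (\<lambda>(g, y). g(m := y)) ` (?B m \<times> {..<M} \<union> ?C)"
  proof
    fix f assume f: "f \<in> ?B (Suc m)"
    define g where "g = f(m := undefined)"
    have "g \<in> ?E m" "f m < M" and fg: "f = g(m := f m)"
      using f by (auto simp: g_def PiE_def extensional_def Pi_def)
    moreover have "f m \<in> g ` {..<m} \<or> \<not> inj_on g {..<m}"
    proof (rule ccontr)
      assume *: "\<not> ?thesis"
      have fg_eq: "f i = g i" if "i < m" for i using that by (simp add: g_def)
      have "inj_on f {..<m}" using * by (auto simp: inj_on_def fg_eq)
      moreover have "f m \<notin> f ` {..<m}" using * by (auto simp: fg_eq image_iff)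
      ultimately have "inj_on f {..<Suc m}" by (simp add: lessThan_Suc inj_on_insert)
      with f show False by simp
    qed
    ultimately have "(g, f m) \<in> ?B m \<times> {..<M} \<union> ?C" by auto
    thus "f \<in> (\<lambda>(g, y). g(m := y)) ` (?B m \<times> {..<M} \<union> ?C)"
      by (rule rev_image_eqI) (use fg in simp)
  qed
  hence "card (?B (Suc m)) \<le> card ((\<lambda>(g, y). g(m := y)) ` (?B m \<times> {..<M} \<union> ?C))"
    using fin by (intro card_mono finite_imageI) auto
  also have "\<dots> \<le> card (?B m \<times> {..<M} \<union> ?C)"
    using fin by (intro card_image_le) auto
  also have "\<dots> \<le> card (?B m) * M + card ?C"
    by (rule order_trans[OF card_Un_le]) (simp add: card_cartesian_product)
  also have "card ?C = (\<Sum>g\<in>?E m. card (g ` {..<m}))"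
    using fin by simp
  also have "\<dots> \<le> (\<Sum>g\<in>?E m. m)"
    by (intro sum_mono order_trans[OF card_image_le]) auto
  also have "\<dots> = M ^ m * m"
    by (simp add: card_PiE)
  finally have "real (card (?B (Suc m))) \<le> real (card (?B m) * M + M ^ m * m)"
    by (simp only: of_nat_le_iff)
  hence "2 * real M * real (card (?B (Suc m))) \<le> 2 * real M * real (card (?B m) * M + M ^ m * m)"
    by (intro mult_left_mono) auto
  also have "\<dots> = (2 * real M * real (card (?B m))) * real M + 2 * real m * real M ^ Suc m"
    by (simp add: algebra_simps)
  also have "\<dots> \<le> (real m * (real m - 1) * real M ^ m) * real M + 2 * real m * real M ^ Suc m"
    using Suc by (intro add_right_mono mult_right_mono) auto
  also have "\<dots> = real (Suc m) * (real (Suc m) - 1) * real M ^ Suc m"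
    by (simp add: algebra_simps)
  finally show ?case .
qed simp

text \<open>The complements of domain and image in \<open>{..<M}\<close> have equal size, so any
  bijection between them completes \<open>f\<close>. Invariance under permutations thereby becomes
  usable for injective selections.\<close>

lemma inj_on_extend_permutes:
  fixes f :: "nat \<Rightarrow> nat"
  assumes inj: "inj_on f {..<m}" and f: "f ` {..<m} \<subseteq> {..<M}" and "m \<le> M"
  shows "\<exists>\<sigma>. \<sigma> permutes {..<M} \<and> (\<forall>i<m. \<sigma> i = f i)"
proof -
  have "card ({..<M} - {..<m}) = card ({..<M} - f ` {..<m})"
    using f \<open>m \<le> M\<close> by (subst (1 2) card_Diff_subset) (auto simp: card_image[OF inj])
  then obtain g where g: "bij_betw g ({..<M} - {..<m}) ({..<M} - f ` {..<m})"
    using finite_same_card_bij[of "{..<M} - {..<m}" "{..<M} - f ` {..<m}"] by auto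
  define \<sigma> where "\<sigma> i = (if i < m then f i else if i < M then g i else i)" for i
  have "bij_betw \<sigma> {..<m} (f ` {..<m})"
    using inj by (subst bij_betw_cong[of _ _ f]) (auto simp: \<sigma>_def bij_betw_def)
  moreover have "bij_betw \<sigma> ({..<M} - {..<m}) ({..<M} - f ` {..<m})"
    using g by (subst bij_betw_cong[of _ _ g]) (auto simp: \<sigma>_def)
  ultimately have "bij_betw \<sigma> ({..<m} \<union> ({..<M} - {..<m})) (f ` {..<m} \<union> ({..<M} - f ` {..<m}))"
    by (rule bij_betw_combine) auto
  moreover have "{..<m} \<union> ({..<M} - {..<m}) = {..<M}" "f ` {..<m} \<union> ({..<M} - f ` {..<m}) = {..<M}"
    using f \<open>m \<le> M\<close> by auto
  ultimately have "bij_betw \<sigma> {..<M} {..<M}" by simp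
  hence "\<sigma> permutes {..<M}"
    by (rule bij_imp_permutes) (use \<open>m \<le> M\<close> in \<open>auto simp: \<sigma>_def\<close>)
  thus ?thesis by (auto simp: \<sigma>_def)
qed

section \<open>Averages over selections of particles\<close>

definition select :: "nat \<Rightarrow> (nat \<Rightarrow> nat) \<Rightarrow> (nat \<Rightarrow> 'a) \<Rightarrow> nat \<Rightarrow> 'a" where
  "select m f X = (\<lambda>i\<in>{..<m}. X (f i))"

lemma select_in_space [simp]: "select m f X \<in> space (configs m)"
  by (simp add: select_def space_configs)

lemma measurable_select:
  assumes "f ` {..<m} \<subseteq> {..<M}"
  shows "select m f \<in> measurable (configs M) (configs m)"
  unfolding select_def using assms
  by (intro measurable_restrict measurable_component_singleton) auto

text \<open>The integral of \<open>\<phi>\<close> against the \<open>m\<close>-fold product of the empirical measure of \<open>X\<close>.\<close>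

definition sample_average :: "nat \<Rightarrow> nat \<Rightarrow> ((nat \<Rightarrow> 'a) \<Rightarrow> real) \<Rightarrow> (nat \<Rightarrow> 'a) \<Rightarrow> real" where
  "sample_average M m \<phi> X = (\<Sum>f\<in>{..<m} \<rightarrow>\<^sub>E {..<M}. \<phi> (select m f X)) / real M ^ m"

text \<open>A uniformly random function is a family of \<open>m\<close> independent uniform indices.
  The default \<open>undefined\<close> of \<open>Pi_pmf\<close> matches the extensionality of
  \<open>\<rightarrow>\<^sub>E\<close>.\<close>

lemma sample_average_eq_expectation:
  assumes M: "0 < M"
  shows "sample_average M m \<phi> X = measure_pmf.expectation
    (Pi_pmf {..<m} undefined (\<lambda>_. pmf_of_set {..<M})) (\<lambda>f. \<phi> (select m f X))"
proof -
  have E: "PiE_dflt {..<m} undefined (\<lambda>_. {..<M}) = {..<m} \<rightarrow>\<^sub>E {..<M}"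
    by (auto simp: PiE_dflt_def PiE_def extensional_def Pi_def)
  have ne: "{..<m} \<rightarrow>\<^sub>E {..<M} \<noteq> {}" using M by (auto simp: PiE_eq_empty_iff lessThan_empty_iff)
  have fin: "finite ({..<m} \<rightarrow>\<^sub>E {..<M})" by (intro finite_PiE) auto
  have "Pi_pmf {..<m} undefined (\<lambda>_. pmf_of_set {..<M}) = pmf_of_set ({..<m} \<rightarrow>\<^sub>E {..<M})"
    using M by (subst Pi_pmf_of_set) (auto simp: E lessThan_empty_iff)
  thus ?thesis
    by (simp add: integral_pmf_of_set[OF ne fin] sample_average_def card_PiE)
qed

lemma sample_average_diff_le:
  assumes p: "p \<in> index_couplings M N" and MN: "0 < M" "0 < N"
    and \<phi>: "\<And>x y. x \<in> space (configs m) \<Longrightarrow> y \<in> space (configs m) \<Longrightarrow>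
      \<bar>\<phi> x - \<phi> y\<bar> \<le> l * (\<Sum>i<m. norm (x i - y i))"
  shows "\<bar>sample_average M m \<phi> X - sample_average N m \<phi> Y\<bar>
    \<le> real m * l * measure_pmf.expectation p (\<lambda>(i, j). norm (X i - Y j))"
proof -
  \<comment> \<open>\<open>m\<close> independent samples of \<open>p\<close>. The default pair is
    chosen so that composing with \<open>fst\<close> or \<open>snd\<close> leaves the default
    \<open>undefined\<close>.\<close>
  define r where "r = Pi_pmf {..<m} (undefined, undefined) (\<lambda>_. p)"
  have "finite (set_pmf p)"
    using set_pmf_index_coupling[OF p MN] finite_subset by blast
  hence "finite (set_pmf r)"
    unfolding r_def by (subst set_Pi_pmf) auto
  hence int: "integrable (measure_pmf r) f" for f :: "_ \<Rightarrow> real"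
    by (rule integrable_measure_pmf_finite)
  have fst: "Pi_pmf {..<m} undefined (\<lambda>_. pmf_of_set {..<M}) = map_pmf (\<lambda>h. fst \<circ> h) r"
    and snd: "Pi_pmf {..<m} undefined (\<lambda>_. pmf_of_set {..<N}) = map_pmf (\<lambda>h. snd \<circ> h) r"
    unfolding r_def using p by (auto simp: index_couplings_def simp flip: Pi_pmf_map)
  let ?n = "\<lambda>(i, j). norm (X i - Y j)"
  have "\<bar>sample_average M m \<phi> X - sample_average N m \<phi> Y\<bar>
      = \<bar>measure_pmf.expectation r (\<lambda>h. \<phi> (select m (fst \<circ> h) X) - \<phi> (select m (snd \<circ> h) Y))\<bar>"
    by (simp add: sample_average_eq_expectation MN fst snd Bochner_Integration.integral_diff[OF int int])
  also have "\<dots> \<le> measure_pmf.expectation r (\<lambda>h. \<bar>\<phi> (select m (fst \<circ> h) X) - \<phi> (select m (snd \<circ> h) Y)\<bar>)"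
    by (rule integral_abs_bound)
  also have "\<dots> \<le> measure_pmf.expectation r (\<lambda>h. l * (\<Sum>i<m. ?n (h i)))"
  proof (rule integral_mono[OF int int])
    fix h
    have "\<bar>\<phi> (select m (fst \<circ> h) X) - \<phi> (select m (snd \<circ> h) Y)\<bar>
        \<le> l * (\<Sum>i<m. norm (select m (fst \<circ> h) X i - select m (snd \<circ> h) Y i))"
      by (rule \<phi>) simp_all
    thus "\<bar>\<phi> (select m (fst \<circ> h) X) - \<phi> (select m (snd \<circ> h) Y)\<bar> \<le> l * (\<Sum>i<m. ?n (h i))"
      by (simp add: select_def case_prod_beta)
  qed
  also have "\<dots> = l * (\<Sum>i<m. measure_pmf.expectation r (\<lambda>h. ?n (h i)))"
    by (subst integral_mult_right_zero, subst Bochner_Integration.integral_sum) (auto intro: int)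
  \<comment> \<open>Every component of \<open>r\<close> has law \<open>p\<close>, so the
    \<open>m\<close> expectations coincide; this is the origin of the factor
    \<open>m\<close>.\<close>
  also have "\<dots> = l * (\<Sum>i<m. measure_pmf.expectation p ?n)"
  proof (intro arg_cong[where f = "(*) l"] sum.cong refl)
    fix i assume "i \<in> {..<m}"
    hence "map_pmf (\<lambda>h. h i) r = p" unfolding r_def by (subst Pi_pmf_component) auto
    thus "measure_pmf.expectation r (\<lambda>h. ?n (h i)) = measure_pmf.expectation p ?n"
      using integral_map_pmf[of "\<lambda>h. h i" r ?n] by simp
  qed
  finally show ?thesis by (simp add: mult_ac)
qed

lemma sample_average_diff_le_dist_MK1:
  assumes MN: "0 < M" "0 < N" and l: "0 \<le> l"
    and \<phi>: "\<And>x y. x \<in> space (configs m) \<Longrightarrow> y \<in> space (configs m) \<Longrightarrow>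
      \<bar>\<phi> x - \<phi> y\<bar> \<le> l * (\<Sum>i<m. norm (x i - y i))"
  shows "ennreal \<bar>sample_average M m \<phi> X - sample_average N m \<phi> Y\<bar>
    \<le> ennreal (real m * l) * dist_MK1 (empirical_measure M X) (empirical_measure N Y)"
  using l by (intro le_cmult_dist_MK1_empiricalI[OF MN] ennreal_leI sample_average_diff_le[OF _ MN \<phi>]) auto

lemma abs_sample_average_le:
  assumes M: "0 < M" and B: "\<And>x. x \<in> space (configs m) \<Longrightarrow> \<bar>\<phi> x\<bar> \<le> B"
  shows "\<bar>sample_average M m \<phi> X\<bar> \<le> B"
proof -
  have "\<bar>\<Sum>f\<in>{..<m} \<rightarrow>\<^sub>E {..<M}. \<phi> (select m f X)\<bar> \<le> (\<Sum>f\<in>{..<m} \<rightarrow>\<^sub>E {..<M}. B)"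
    by (rule order_trans[OF sum_abs]) (intro sum_mono B select_in_space)
  thus ?thesis using M by (simp add: sample_average_def card_PiE field_simps)
qed

lemma measurable_sample_average:
  assumes "\<phi> \<in> borel_measurable (configs m)"
  shows "sample_average M m \<phi> \<in> borel_measurable (configs M)"
  unfolding sample_average_def
  by (intro borel_measurable_divide borel_measurable_sum borel_measurable_const
      measurable_compose[OF measurable_select assms]) auto

text \<open>By symmetry every injective \<open>f\<close> contributes the integral of \<open>\<phi>\<close> against the marginal, so
  only the few non-injective ones cause an error.\<close>

lemma integral_sample_average_close:
  fixes P :: "(nat \<Rightarrow> 'a::euclidean_space) measure"
  assumes P: "prob_space P" "sets P = sets (configs M)" "symmetric_measure M P"
    and \<phi> [measurable]: "\<phi> \<in> borel_measurable (configs m)"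
    and B: "\<And>x. x \<in> space (configs m) \<Longrightarrow> \<bar>\<phi> x\<bar> \<le> B"
    and m: "m \<le> M" and M: "0 < M"
  shows "\<bar>(\<integral>X. sample_average M m \<phi> X \<partial>P) - (\<integral>x. \<phi> x \<partial>marginal m P)\<bar>
    \<le> B * (real m * (real m - 1) / real M)"
proof -
  interpret prob_space P by fact
  note [measurable_cong] = P(2)
  let ?E = "{..<m} \<rightarrow>\<^sub>E {..<M}"
  define I where "I f = (\<integral>X. \<phi> (select m f X) \<partial>P)" for f
  define I0 where "I0 = (\<integral>x. \<phi> x \<partial>marginal m P)"
  have fin: "finite ?E" by (intro finite_PiE) auto
  have B0: "0 \<le> B" using order_trans[OF abs_ge_zero B, OF select_in_space] .
  have meas: "select m f \<in> measurable P (configs m)" if "f ` {..<m} \<subseteq> {..<M}" for f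
    using measurable_select[OF that] unfolding measurable_cong_sets[OF P(2) refl] .
  have int: "integrable P (\<lambda>X. \<phi> (select m f X))" if "f ` {..<m} \<subseteq> {..<M}" for f
    using measurable_compose[OF meas[OF that] \<phi>] B by (intro integrable_const_bound[of _ B]) auto
  have I_bound: "\<bar>I f\<bar> \<le> B" if "f ` {..<m} \<subseteq> {..<M}" for f
  proof -
    have "\<bar>I f\<bar> \<le> (\<integral>X. B \<partial>P)"
      unfolding I_def by (rule order_trans[OF integral_abs_bound])
        (intro integral_mono integrable_abs int that B select_in_space, auto)
    thus ?thesis by (simp add: prob_space)
  qed
  have I0: "I0 = I id"
  proof -
    have "(\<lambda>z. restrict z {..<m}) = (select m id :: (nat \<Rightarrow> 'a) \<Rightarrow> _)"
      by (auto simp: select_def fun_eq_iff)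
    thus ?thesis
      unfolding I0_def I_def marginal_def using m by (simp add: integral_distr[OF meas \<phi>])
  qed
  \<comment> \<open>Extend \<open>f\<close> to a permutation \<open>\<sigma>\<close>: the first
    \<open>m\<close> particles of the permuted configuration are those selected by \<open>f\<close>,
    and \<open>P\<close> is invariant.\<close>
  have I_inj: "I f = I0" if f: "f ` {..<m} \<subseteq> {..<M}" "inj_on f {..<m}" for f
  proof -
    obtain \<sigma> where \<sigma>: "\<sigma> permutes {..<M}" "\<And>i. i < m \<Longrightarrow> \<sigma> i = f i"
      using inj_on_extend_permutes[OF f(2,1) m] by blast
    have perm: "permute_config M \<sigma> \<in> measurable P (configs M)"
      using measurable_select[of \<sigma> M M] permutes_image[OF \<sigma>(1)]
      unfolding measurable_cong_sets[OF P(2) refl]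
      by (simp add: permute_config_def[abs_def] select_def[abs_def])
    have sel: "(\<lambda>X. \<phi> (select m id X)) \<in> borel_measurable (configs M)"
      using m by (intro measurable_compose[OF measurable_select \<phi>]) auto
    have "I id = (\<integral>X. \<phi> (select m id X) \<partial>distr P (configs M) (permute_config M \<sigma>))"
      using P(3) \<sigma>(1) by (simp add: I_def symmetric_measure_def)
    also have "\<dots> = (\<integral>X. \<phi> (select m id (permute_config M \<sigma> X)) \<partial>P)"
      by (rule integral_distr[OF perm sel])
    also have "\<dots> = I f"
      unfolding I_def using \<sigma>(2) m
      by (intro Bochner_Integration.integral_cong refl arg_cong[where f = \<phi>])
        (auto simp: select_def permute_config_def fun_eq_iff)
    finally show ?thesis by (simp add: I0)
  qed
  have "(\<integral>X. sample_average M m \<phi> X \<partial>P) = (\<Sum>f\<in>?E. I f) / real M ^ m"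
    unfolding sample_average_def I_def
    by (subst integral_divide_zero, subst Bochner_Integration.integral_sum) (auto intro!: int)
  also have "\<dots> - I0 = (\<Sum>f\<in>?E. I f - I0) / real M ^ m"
    using M by (simp add: sum_subtractf card_PiE diff_divide_distrib)
  also have "(\<Sum>f\<in>?E. I f - I0) = (\<Sum>f\<in>{f\<in>?E. \<not> inj_on f {..<m}}. I f - I0)"
  proof (intro sum.mono_neutral_right fin ballI)
    fix f assume "f \<in> ?E - {f\<in>?E. \<not> inj_on f {..<m}}"
    hence "f ` {..<m} \<subseteq> {..<M}" "inj_on f {..<m}" by auto
    thus "I f - I0 = 0" using I_inj by simp
  qed auto
  finally have eq: "(\<integral>X. sample_average M m \<phi> X \<partial>P) - I0
      = (\<Sum>f\<in>{f\<in>?E. \<not> inj_on f {..<m}}. I f - I0) / real M ^ m" .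
  \<comment> \<open>Both \<open>I f\<close> and \<open>I0\<close> are bounded by \<open>B\<close>;
    the resulting 2 is absorbed by the one in \<open>card_not_inj_on_le\<close>.\<close>
  have "\<bar>\<Sum>f\<in>{f\<in>?E. \<not> inj_on f {..<m}}. I f - I0\<bar> \<le> (\<Sum>f\<in>{f\<in>?E. \<not> inj_on f {..<m}}. 2 * B)"
    unfolding real_norm_def[symmetric]
  proof (rule sum_norm_le)
    fix f assume "f \<in> {f\<in>?E. \<not> inj_on f {..<m}}"
    hence "f ` {..<m} \<subseteq> {..<M}" "id ` {..<m} \<subseteq> {..<M}" using m by auto
    from this[THEN I_bound] show "norm (I f - I0) \<le> 2 * B" unfolding I0 real_norm_def by linarith
  qed
  also have "\<dots> = B / real M * (2 * real M * real (card {f\<in>?E. \<not> inj_on f {..<m}}))"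
    using M by simp
  also have "\<dots> \<le> B / real M * (real m * (real m - 1) * real M ^ m)"
    using B0 by (intro mult_left_mono card_not_inj_on_le M) auto
  finally show ?thesis
    using M unfolding eq I0_def[symmetric] by (simp add: field_simps)
qed

text \<open>A static estimate, to be applied to the laws at time \<open>t\<close>. The transport
  term compares the two sample averages, and each marginal contributes the error of replacing it by
  its average.\<close>

lemma marginal_integral_diff_le:
  fixes P Q :: "(nat \<Rightarrow> 'a::euclidean_space) measure"
  assumes P: "prob_space P" "sets P = sets (configs M)" "symmetric_measure M P"
    and Q: "prob_space Q" "sets Q = sets (configs N)" "symmetric_measure N Q"
    and MN: "0 < M" "0 < N" and m: "m \<le> M" "m \<le> N" and l: "0 \<le> l"
    and \<phi>: "\<And>x y. x \<in> space (configs m) \<Longrightarrow> y \<in> space (configs m) \<Longrightarrow>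
      \<bar>\<phi> x - \<phi> y\<bar> \<le> l * (\<Sum>i<m. norm (x i - y i))"
    and B: "\<And>x. x \<in> space (configs m) \<Longrightarrow> \<bar>\<phi> x\<bar> \<le> B"
  shows "ennreal \<bar>(\<integral>z. \<phi> z \<partial>marginal m P) - (\<integral>z. \<phi> z \<partial>marginal m Q)\<bar>
    \<le> ennreal (real m * l) * Dist_MK1 M N P Q
      + ennreal (B * (real m * (real m - 1)) * (1 / real M + 1 / real N))"
proof -
  interpret P: prob_space P by fact
  interpret Q: prob_space Q by fact
  have B0: "0 \<le> B" using order_trans[OF abs_ge_zero B, OF select_in_space] .
  have \<phi>_meas: "\<phi> \<in> borel_measurable (configs m)"
    using \<phi> by (intro borel_measurable_configsI[where C = l]) (simp add: dist_real_def)
  let ?A = "\<lambda>X. sample_average M m \<phi> X" and ?A' = "\<lambda>Y. sample_average N m \<phi> Y"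
  have averages: "ennreal \<bar>(\<integral>X. ?A X \<partial>P) - (\<integral>Y. ?A' Y \<partial>Q)\<bar> \<le> ennreal (real m * l) * Dist_MK1 M N P Q"
    unfolding Dist_MK1_def
  proof (rule le_cmult_INF_ennreal)
    show "couplings P Q \<noteq> {}" using P(1) Q(1) by (rule couplings_nonempty)
    fix \<rho> assume \<rho>: "\<rho> \<in> couplings P Q"
    interpret \<rho>: prob_space \<rho> using \<rho> by (simp add: couplings_def)
    have sets_\<rho>: "sets \<rho> = sets (P \<Otimes>\<^sub>M Q)" and \<rho>P: "distr \<rho> P fst = P" and \<rho>Q: "distr \<rho> Q snd = Q"
      using \<rho> by (auto simp: couplings_def)
    have fst: "fst \<in> measurable \<rho> P" and snd: "snd \<in> measurable \<rho> Q"
      by (simp_all add: measurable_cong_sets[OF sets_\<rho> refl])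
    have A: "?A \<in> borel_measurable P" "?A' \<in> borel_measurable Q"
      using measurable_sample_average[OF \<phi>_meas] P(2) Q(2) by (simp_all cong: measurable_cong_sets)
    have int: "integrable \<rho> (\<lambda>s. ?A (fst s))" "integrable \<rho> (\<lambda>s. ?A' (snd s))"
      by (intro \<rho>.integrable_const_bound[of _ B] AE_I2
          measurable_compose[OF fst A(1)] measurable_compose[OF snd A(2)];
          simp add: abs_sample_average_le MN B)+
    have "(\<integral>X. ?A X \<partial>P) = (\<integral>s. ?A (fst s) \<partial>\<rho>)"
      using A(1) fst by (subst \<rho>P[symmetric], subst integral_distr) auto
    moreover have "(\<integral>Y. ?A' Y \<partial>Q) = (\<integral>s. ?A' (snd s) \<partial>\<rho>)"
      using A(2) snd by (subst \<rho>Q[symmetric], subst integral_distr) auto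
    ultimately have "(\<integral>X. ?A X \<partial>P) - (\<integral>Y. ?A' Y \<partial>Q) = (\<integral>s. ?A (fst s) - ?A' (snd s) \<partial>\<rho>)"
      using int by simp
    hence "ennreal \<bar>(\<integral>X. ?A X \<partial>P) - (\<integral>Y. ?A' Y \<partial>Q)\<bar> \<le> (\<integral>\<^sup>+ s. ennreal \<bar>?A (fst s) - ?A' (snd s)\<bar> \<partial>\<rho>)"
      using integral_norm_bound_ennreal[OF Bochner_Integration.integrable_diff[OF int]] by simp
    also have "\<dots> \<le> (\<integral>\<^sup>+ s. ennreal (real m * l) *
        (case s of (X, Y) \<Rightarrow> dist_MK1 (empirical_measure M X) (empirical_measure N Y)) \<partial>\<rho>)"
      unfolding case_prod_beta
      by (intro nn_integral_mono sample_average_diff_le_dist_MK1 MN l \<phi>)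
    also have "\<dots> \<le> ennreal (real m * l) *
        (\<integral>\<^sup>+ (X, Y). dist_MK1 (empirical_measure M X) (empirical_measure N Y) \<partial>\<rho>)"
      using l by (intro nn_integral_cmult_le) simp
    finally show "ennreal \<bar>(\<integral>X. ?A X \<partial>P) - (\<integral>Y. ?A' Y \<partial>Q)\<bar> \<le> \<dots>" .
  qed (use l in simp)
  have errors: "\<bar>(\<integral>z. \<phi> z \<partial>marginal m P) - (\<integral>z. \<phi> z \<partial>marginal m Q)\<bar>
      \<le> \<bar>(\<integral>X. ?A X \<partial>P) - (\<integral>Y. ?A' Y \<partial>Q)\<bar> + B * (real m * (real m - 1)) * (1 / real M + 1 / real N)"
  proof -
    have "\<bar>(\<integral>X. ?A X \<partial>P) - (\<integral>z. \<phi> z \<partial>marginal m P)\<bar> \<le> B * (real m * (real m - 1) / real M)"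
      "\<bar>(\<integral>Y. ?A' Y \<partial>Q) - (\<integral>z. \<phi> z \<partial>marginal m Q)\<bar> \<le> B * (real m * (real m - 1) / real N)"
      by (intro integral_sample_average_close P Q \<phi>_meas B MN m; assumption)+
    moreover have "B * (real m * (real m - 1)) * (1 / real M + 1 / real N)
        = B * (real m * (real m - 1) / real M) + B * (real m * (real m - 1) / real N)"
      by (simp add: distrib_left)
    ultimately show ?thesis by linarith
  qed
  \<comment> \<open>Splitting \<open>ennreal\<close> of a sum needs nonnegative terms. At
    \<open>m = 0\<close> the factor \<open>real m - 1\<close> is negative, but the product is
    0.\<close>
  have "0 \<le> real m * (real m - 1)" by (cases m) auto
  hence "0 \<le> B * (real m * (real m - 1))" using B0 by (rule mult_nonneg_nonneg[rotated])
  hence "0 \<le> B * (real m * (real m - 1)) * (1 / real M + 1 / real N)"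
    by (rule mult_nonneg_nonneg) simp
  with errors have "ennreal \<bar>(\<integral>z. \<phi> z \<partial>marginal m P) - (\<integral>z. \<phi> z \<partial>marginal m Q)\<bar>
    \<le> ennreal \<bar>(\<integral>X. ?A X \<partial>P) - (\<integral>Y. ?A' Y \<partial>Q)\<bar>
      + ennreal (B * (real m * (real m - 1)) * (1 / real M + 1 / real N))"
    by (simp add: ennreal_leI flip: ennreal_plus)
  also have "\<dots> \<le> ennreal (real m * l) * Dist_MK1 M N P Q
      + ennreal (B * (real m * (real m - 1)) * (1 / real M + 1 / real N))"
    using averages by (rule add_right_mono)
  finally show ?thesis .
qed

text \<open>A real \<open>SUP\<close> is informative only over a nonempty set of values bounded
  above; the Lipschitz hypothesis gives the bound and \<open>1 \<le> m\<close> two distinct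
  configurations. The Euclidean distance is relaxed to the sum over particles, whose expectation
  splits into one term per particle.\<close>

lemma
  fixes \<phi> :: "(nat \<Rightarrow> 'a::euclidean_space) \<Rightarrow> real"
  assumes \<phi>: "lipschitz_config_fun m \<phi>" and m: "1 \<le> m"
  shows Lip_nonneg: "0 \<le> Lip m \<phi>"
    and abs_diff_le_Lip: "x \<in> space (configs m) \<Longrightarrow> y \<in> space (configs m) \<Longrightarrow>
      \<bar>\<phi> x - \<phi> y\<bar> \<le> Lip m \<phi> * (\<Sum>i<m. norm (x i - y i))"
proof -
  let ?S = "{(x, y). x \<in> space (configs m) \<and> y \<in> space (configs m) \<and> x \<noteq> (y :: nat \<Rightarrow> 'a)}"
  let ?q = "\<lambda>(x, y). \<bar>\<phi> x - \<phi> y\<bar> / config_dist m x y"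
  obtain C where C: "\<And>x y. x \<in> space (configs m) \<Longrightarrow> y \<in> space (configs m) \<Longrightarrow>
      \<bar>\<phi> x - \<phi> y\<bar> \<le> C * config_dist m x y"
    using \<phi> by (auto simp: lipschitz_config_fun_def)
  have dist_pos: "0 < config_dist m x y" if "(x, y) \<in> ?S" for x y
  proof -
    have "\<exists>i<m. x i \<noteq> y i"
      using that by (auto simp: space_configs PiE_def extensional_def fun_eq_iff) (metis not_le lessThan_iff)
    then obtain i where i: "i < m" "x i \<noteq> y i" by blast
    hence "0 < (\<Sum>i<m. (norm (x i - y i))\<^sup>2)"
      by (intro sum_pos2[of _ i]) auto
    thus ?thesis by (simp add: config_dist_def)
  qed
  have bdd: "bdd_above (?q ` ?S)"
  proof (rule bdd_aboveI2)
    fix s assume "s \<in> ?S"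
    thus "?q s \<le> C" using C dist_pos by (auto simp: field_simps split: prod.splits)
  qed
  have q_le: "?q (x, y) \<le> Lip m \<phi>" if "(x, y) \<in> ?S" for x y
    unfolding Lip_def by (rule cSUP_upper[OF that bdd])
  show "0 \<le> Lip m \<phi>"
  proof -
    obtain b :: 'a where "b \<noteq> 0" using nonzero_Basis nonempty_Basis by blast
    hence "((\<lambda>i\<in>{..<m}. 0), (\<lambda>i\<in>{..<m}. b)) \<in> ?S"
      using m by (auto simp: space_configs fun_eq_iff intro!: exI[of _ 0])
    from order_trans[OF _ q_le[OF this]] dist_pos[OF this] show ?thesis by simp
  qed
  show "\<bar>\<phi> x - \<phi> y\<bar> \<le> Lip m \<phi> * (\<Sum>i<m. norm (x i - y i))"
    if "x \<in> space (configs m)" "y \<in> space (configs m)"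
  proof (cases "x = y")
    case False
    with that have S: "(x, y) \<in> ?S" by simp
    have "\<bar>\<phi> x - \<phi> y\<bar> \<le> Lip m \<phi> * config_dist m x y"
      using q_le[OF S] dist_pos[OF S] by (simp add: field_simps)
    also have "config_dist m x y \<le> (\<Sum>i<m. norm (x i - y i))"
      unfolding config_dist_def L2_set_def[symmetric] by (rule L2_set_le_sum) simp
    finally show ?thesis using \<open>0 \<le> Lip m \<phi>\<close> by (simp add: mult_left_mono)
  qed simp
qed

lemma abs_le_Linf_norm:
  assumes "bounded_config_fun m \<phi>" "x \<in> space (configs m)"
  shows "\<bar>\<phi> x\<bar> \<le> Linf_norm m \<phi>"
proof -
  obtain B where "\<And>x. x \<in> space (configs m) \<Longrightarrow> \<bar>\<phi> x\<bar> \<le> B"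
    using assms(1) by (auto simp: bounded_config_fun_def)
  hence "bdd_above ((\<lambda>x. \<bar>\<phi> x\<bar>) ` space (configs m))" by (rule bdd_aboveI2)
  thus ?thesis unfolding Linf_norm_def by (rule cSUP_upper[OF assms(2)])
qed

context lipschitz_interaction
begin

lemma
  assumes n: "0 < n" and P: "prob_space P" "sets P = sets (configs n)"
  shows prob_space_evolve: "prob_space (evolve K n t P)"
    and symmetric_evolve: "symmetric_measure n P \<Longrightarrow> symmetric_measure n (evolve K n t P)"
proof -
  have flow: "particle_flow K n t \<in> measurable P (configs n)"
    using measurable_particle_flow[OF n] P(2) by (simp cong: measurable_cong_sets)
  show "prob_space (evolve K n t P)"
    unfolding evolve_def using P(1) flow by (rule prob_space.prob_space_distr)
  assume sym: "symmetric_measure n P"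
  show "symmetric_measure n (evolve K n t P)"
    unfolding symmetric_measure_def
  proof safe
    fix \<sigma> assume \<sigma>: "\<sigma> permutes {..<n}"
    have perm: "permute_config n \<sigma> \<in> measurable (configs n) (configs n)"
      using measurable_select[of \<sigma> n n] permutes_image[OF \<sigma>]
      by (simp add: permute_config_def[abs_def] select_def[abs_def])
    hence perm': "permute_config n \<sigma> \<in> measurable P (configs n)"
      using P(2) by (simp cong: measurable_cong_sets)
    have "distr (evolve K n t P) (configs n) (permute_config n \<sigma>)
        = distr P (configs n) (\<lambda>x. permute_config n \<sigma> (particle_flow K n t x))"
      unfolding evolve_def by (subst distr_distr[OF perm flow]) (simp add: o_def)
    \<comment> \<open>The flow commutes with relabelling, so the permutation can be moved onto the
      initial law.\<close>
    also have "\<dots> = distr P (configs n) (\<lambda>x. particle_flow K n t (permute_config n \<sigma> x))"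
      using sets_eq_imp_space_eq[OF P(2)]
      by (intro distr_cong refl) (metis particle_flow_permute[OF \<sigma> _ n])
    also have "\<dots> = distr (distr P (configs n) (permute_config n \<sigma>)) (configs n) (particle_flow K n t)"
      by (subst distr_distr[OF measurable_particle_flow[OF n] perm']) (simp add: o_def)
    also have "distr P (configs n) (permute_config n \<sigma>) = P"
      using sym \<sigma> by (simp add: symmetric_measure_def)
    finally show "distr (evolve K n t P) (configs n) (permute_config n \<sigma>) = evolve K n t P"
      by (simp add: evolve_def)
  qed
qed

end

theorem theorem4p1:
  fixes K :: "real ^ 'd \<Rightarrow> real ^ 'd \<Rightarrow> real ^ 'd"
    and L :: real
    and M N :: nat
    and P_in Q_in :: "(nat \<Rightarrow> real ^ 'd) measure"
  assumes K_continuous: "continuous_on UNIV (\<lambda>(z, z'). K z z')"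
    and K_antisym: "\<And>z z'. K z z' + K z' z = 0"
    and K_Lipschitz_1: "\<And>z1 z2 z'. norm (K z1 z' - K z2 z') \<le> L * norm (z1 - z2)"
    and K_Lipschitz_2: "\<And>z1 z2 z. norm (K z z1 - K z z2) \<le> L * norm (z1 - z2)"
    and M: "M \<ge> 1"
    and N: "N \<ge> 1"
    and P_in: "P_in \<in> P1_configs M" "symmetric_measure M P_in"
    and Q_in: "Q_in \<in> P1_configs N" "symmetric_measure N Q_in"
  shows
    "(\<forall>t. Dist_MK1 M N (evolve K M t P_in) (evolve K N t Q_in)
            \<le> ennreal (exp (2 * L * \<bar>t\<bar>)) * Dist_MK1 M N P_in Q_in) \<and>
     (\<forall>t m \<phi>. 1 \<le> m \<and> m \<le> M \<and> m \<le> N \<and> bounded_config_fun m \<phi> \<and> lipschitz_config_fun m \<phi> \<longrightarrow>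
        ennreal \<bar>(\<integral>z. \<phi> z \<partial>marginal m (evolve K M t P_in)) -
                 (\<integral>z. \<phi> z \<partial>marginal m (evolve K N t Q_in))\<bar>
          \<le> of_nat m *
              (ennreal (exp (2 * L * \<bar>t\<bar>)) * ennreal (Lip m \<phi>) * Dist_MK1 M N P_in Q_in +
               ennreal ((real m - 1) * Linf_norm m \<phi> * (1 / real M + 1 / real N))))"
proof -
  interpret lipschitz_interaction K L
  proof
    \<comment> \<open>A unit vector tests the Lipschitz bound and shows
      \<open>0 \<le> L\<close>.\<close>
    obtain b :: "real ^ 'd" where b: "b \<in> Basis" using nonempty_Basis by blast
    have "0 \<le> norm (K b 0 - K 0 0)" by simp
    also have "\<dots> \<le> L" using K_Lipschitz_1[of b 0 0] b by simp
    finally show "0 \<le> L" .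
  qed (rule K_Lipschitz_1 K_Lipschitz_2)+
  have MN: "0 < M" "0 < N" using M N by auto
  have P: "prob_space P_in" "sets P_in = sets (configs M)"
    and Q: "prob_space Q_in" "sets Q_in = sets (configs N)"
    using P_in Q_in by (auto simp: P1_configs_def)
  note a = Dist_MK1_evolve_le[OF P(2) Q(2) MN]
  have "ennreal \<bar>(\<integral>z. \<phi> z \<partial>marginal m (evolve K M t P_in)) -
                 (\<integral>z. \<phi> z \<partial>marginal m (evolve K N t Q_in))\<bar>
          \<le> of_nat m *
              (ennreal (exp (2 * L * \<bar>t\<bar>)) * ennreal (Lip m \<phi>) * Dist_MK1 M N P_in Q_in +
               ennreal ((real m - 1) * Linf_norm m \<phi> * (1 / real M + 1 / real N)))"
    if m: "1 \<le> m" "m \<le> M" "m \<le> N" and bounded: "bounded_config_fun m \<phi>"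
      and lipschitz: "lipschitz_config_fun m \<phi>" for t m \<phi>
  proof -
    have l: "0 \<le> Lip m \<phi>" by (rule Lip_nonneg[OF lipschitz m(1)])
    have eq: "ennreal (real m * Lip m \<phi>) * (c * d) + ennreal (real m * e)
        = of_nat m * (c * ennreal (Lip m \<phi>) * d + ennreal e)" for c d e
      unfolding ennreal_mult'[OF of_nat_0_le_iff] ennreal_of_nat_eq_real_of_nat distrib_left
      by (simp add: mult_ac)
    have "ennreal \<bar>(\<integral>z. \<phi> z \<partial>marginal m (evolve K M t P_in)) -
                 (\<integral>z. \<phi> z \<partial>marginal m (evolve K N t Q_in))\<bar>
        \<le> ennreal (real m * Lip m \<phi>) * Dist_MK1 M N (evolve K M t P_in) (evolve K N t Q_in)
          + ennreal (Linf_norm m \<phi> * (real m * (real m - 1)) * (1 / real M + 1 / real N))"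
      by (intro marginal_integral_diff_le prob_space_evolve symmetric_evolve P Q P_in(2) Q_in(2) MN m l
          abs_diff_le_Lip[OF lipschitz m(1)] abs_le_Linf_norm[OF bounded]) (simp_all add: evolve_def)
    \<comment> \<open>Part (a) brings the distance back to time 0; the exponential factor enters (b)
      only here.\<close>
    also have "\<dots> \<le> ennreal (real m * Lip m \<phi>) * (ennreal (exp (2 * L * \<bar>t\<bar>)) * Dist_MK1 M N P_in Q_in)
          + ennreal (real m * ((real m - 1) * Linf_norm m \<phi> * (1 / real M + 1 / real N)))"
      by (intro add_mono mult_left_mono a) (simp_all add: mult_ac)
    also have "\<dots> = of_nat m *
              (ennreal (exp (2 * L * \<bar>t\<bar>)) * ennreal (Lip m \<phi>) * Dist_MK1 M N P_in Q_in +
               ennreal ((real m - 1) * Linf_norm m \<phi> * (1 / real M + 1 / real N)))"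
      by (rule eq)
    finally show ?thesis .
  qed
  with a show ?thesis by blast
qed

end
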